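(* Let $n\ge 2$ be a natural number and let $\mathcal{A}=(A;E_i)_{i\in n}$ be an $n$-grid. Then $\mathcal{A}$ is twisted if and only if $\mathcal{A}$ admits an acceptable coloring.
   Context: For a natural number $n\ge 2$, an $n$-grid is a structure $\mathcal{A}=(A;E_i)_{i\in n}$ where each $E_i$ is an equivalence relation on the set $A$ and $[a]_i\cap[a]_j$ is finite whenever $a\in A$ and $i<j<n$; here $[a]_i$ denotes the $E_i$-equivalence class of $a$. An acceptable coloring of $\mathcal{A}$ is a function $\chi:A\to n$ such that $[a]_i\cap\chi^{-1}(i)$ is finite for all $a\in A$ and $i\in n$. Given an equivalence relation $E$ on $A$, a set $B\subseteq A$ is $E$-small if every $E$-equivalence class intersects $B$ in a finite set. An "elementary submodel of the universe" means a set $M$ with $(M,\in)\prec(H(\theta),\in)$, where $H(\theta)$ is the set of sets of hereditary cardinality $<\theta$ and $\theta$ is a fixed, sufficiently large regular cardinal (e.g. $\theta=(2^{|A|})^+$ when $A$ is transitive). A test set for $\mathcal{A}$ is a set $\mathcal{M}$ of elementary submodels of the universe such that $\mathcal{A}\in M$ for every $M\in\mathcal{M}$, $|\mathcal{M}|=n-1$, and $\mathcal{M}$ is linearly ordered by $\in$. The $n$-grid $\mathcal{A}$ is twisted if for every test set $\mathcal{M}$ for $\mathcal{A}$ and every $k\in n$, the set $\{x\in A\setminus\bigcup\mathcal{M} : [x]_i\in\bigcup\mathcal{M}\text{ for all } i\in n\setminus\{k\}\}$ is $E_k$-small. *)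

theory Defs
  imports "HOL-Library.FuncSet"
begin

unbundle cardinal_syntax

section \<open>Hereditarily small sets\<close>

text \<open>
  HOL has no type of all sets.  For every type \<open>'k\<close> we construct the type \<open>'k hs\<close> of the pure
  well-founded sets that, hereditarily, have at most \<open>|'k|\<close> elements: well-founded trees
  with at most \<open>|'k|\<close> children at every node, modulo extensional equality.
  As \<open>'k\<close> is a type variable, the ambient universe is as large as one likes.
  The lemmas below (extensionality, foundation, the size bound, comprehension for
  at most \<open>|'k|\<close> elements) determine \<open>'k hs\<close> up to isomorphism.
\<close>

datatype 'k tree = Tree "'k \<Rightarrow> 'k tree option"

primrec children :: "'k tree \<Rightarrow> 'k tree set" where
  "children (Tree f) = {t. Some t \<in> range f}"

inductive ext_eq :: "'k tree \<Rightarrow> 'k tree \<Rightarrow> bool" where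
  "(\<forall>t\<in>children x. \<exists>u\<in>children y. ext_eq t u) \<Longrightarrow> (\<forall>u\<in>children y. \<exists>t\<in>children x. ext_eq t u)
    \<Longrightarrow> ext_eq x y"

lemma tree_induct_children:
  assumes "\<And>x. (\<And>t. t \<in> children x \<Longrightarrow> P t) \<Longrightarrow> P x"
  shows "P (x :: 'k tree)"
proof (induction x)
  case (Tree f)
  show ?case
  proof (rule assms)
    fix t assume "t \<in> children (Tree f)"
    then obtain k where "f k = Some t" by (auto simp: image_iff)
    then show "P t" using Tree[of "Some t" t] by (metis rangeI option.set_intros)
  qed
qed

lemma ext_eq_iff:
  "ext_eq x y \<longleftrightarrow> (\<forall>t\<in>children x. \<exists>u\<in>children y. ext_eq t u) \<and>
    (\<forall>u\<in>children y. \<exists>t\<in>children x. ext_eq t u)"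
  by (subst ext_eq.simps) simp

lemma ext_eq_refl: "ext_eq x x"
  by (induction x rule: tree_induct_children) (subst ext_eq_iff, blast)

lemma ext_eq_sym: "ext_eq x y \<Longrightarrow> ext_eq y x"
proof (induction x arbitrary: y rule: tree_induct_children)
  case (1 x)
  from "1.prems" show ?case
    unfolding ext_eq_iff[of x y] ext_eq_iff[of y x] using "1.IH" by blast
qed

lemma ext_eq_trans: "ext_eq x y \<Longrightarrow> ext_eq y z \<Longrightarrow> ext_eq x z"
proof (induction x arbitrary: y z rule: tree_induct_children)
  case (1 x)
  have xy: "\<forall>t\<in>children x. \<exists>u\<in>children y. ext_eq t u" "\<forall>u\<in>children y. \<exists>t\<in>children x. ext_eq t u"
    using "1.prems"(1) unfolding ext_eq_iff[of x y] by blast+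
  have yz: "\<forall>t\<in>children y. \<exists>u\<in>children z. ext_eq t u" "\<forall>u\<in>children z. \<exists>t\<in>children y. ext_eq t u"
    using "1.prems"(2) unfolding ext_eq_iff[of y z] by blast+
  show ?case
    unfolding ext_eq_iff[of x z]
  proof (intro conjI ballI)
    fix t assume t: "t \<in> children x"
    then obtain u where u: "u \<in> children y" "ext_eq t u" using xy by blast
    then obtain v where "v \<in> children z" "ext_eq u v" using yz by blast
    then show "\<exists>u\<in>children z. ext_eq t u" using "1.IH"[OF t] u by blast
  next
    fix v assume "v \<in> children z"
    then obtain u where u: "u \<in> children y" "ext_eq u v" using yz by blast
    then obtain t where "t \<in> children x" "ext_eq t u" using xy by blast
    then show "\<exists>t\<in>children x. ext_eq t v" using "1.IH" u by blast
  qed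
qed

quotient_type 'k hs = "'k tree" / ext_eq
  by (intro equivpI reflpI sympI transpI) (blast intro: ext_eq_refl ext_eq_sym ext_eq_trans)+

definition elts :: "'k hs \<Rightarrow> 'k hs set" where
  "elts x = abs_hs ` children (rep_hs x)"

lemma abs_hs_eq_iff: "abs_hs s = abs_hs t \<longleftrightarrow> ext_eq s t"
  by (rule hs.abs_eq_iff)

lemma ext_eq_rep_abs: "ext_eq (rep_hs (abs_hs t)) t"
  by (rule Quotient3_rep_abs[OF Quotient3_hs]) (rule ext_eq_refl)

lemma abs_rep_hs: "abs_hs (rep_hs x) = x"
  by (rule Quotient3_abs_rep[OF Quotient3_hs])

lemma elts_abs_hs: "elts (abs_hs t) = abs_hs ` children t"
  using ext_eq_rep_abs[of t] unfolding elts_def ext_eq_iff[of "rep_hs (abs_hs t)"]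
  by (auto simp: image_iff abs_hs_eq_iff) (metis ext_eq_sym)

lemma hs_extensionality: "elts x = elts y \<Longrightarrow> x = y"
proof -
  assume "elts x = elts y"
  then have *: "abs_hs ` children (rep_hs x) = abs_hs ` children (rep_hs y)"
    by (simp add: elts_def)
  have "ext_eq (rep_hs x) (rep_hs y)"
    unfolding ext_eq_iff[of "rep_hs x"]
  proof (intro conjI ballI)
    fix t assume "t \<in> children (rep_hs x)"
    then have "abs_hs t \<in> abs_hs ` children (rep_hs y)" using * by blast
    then show "\<exists>u\<in>children (rep_hs y). ext_eq t u" by (auto simp: abs_hs_eq_iff)
  next
    fix u assume "u \<in> children (rep_hs y)"
    then have "abs_hs u \<in> abs_hs ` children (rep_hs x)" using * by blast
    then show "\<exists>t\<in>children (rep_hs x). ext_eq t u"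
      using ext_eq_sym by (fastforce simp: abs_hs_eq_iff)
  qed
  then have "abs_hs (rep_hs x) = abs_hs (rep_hs y)" by (simp add: abs_hs_eq_iff)
  then show "x = y" by (simp add: abs_rep_hs)
qed

lemma hs_foundation: "wf {(x, y). x \<in> elts (y :: 'k hs)}"
proof (rule wfUNIVI)
  fix P :: "'k hs \<Rightarrow> bool" and x
  assume IH: "\<forall>x. (\<forall>y. (y, x) \<in> {(x, y). x \<in> elts y} \<longrightarrow> P y) \<longrightarrow> P x"
  have "P (abs_hs t)" for t
  proof (induction t rule: tree_induct_children)
    case (1 t)
    then have "\<forall>y\<in>elts (abs_hs t). P y" by (simp add: elts_abs_hs)
    with IH show ?case by blast
  qed
  from this[of "rep_hs x"] show "P x" by (simp add: abs_rep_hs)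
qed

lemma card_elts: "|elts (x :: 'k hs)| \<le>o |UNIV :: 'k set|"
proof -
  obtain f where f: "rep_hs x = Tree f" by (cases "rep_hs x")
  have "elts x \<subseteq> (\<lambda>k. abs_hs (the (f k))) ` UNIV"
    by (auto simp: elts_def f image_iff) (metis option.sel)
  then show ?thesis by (meson card_of_image card_of_mono1 ordLeq_transitive)
qed

lemma hs_comprehension:
  assumes "|X :: 'k hs set| \<le>o |UNIV :: 'k set|"
  shows "\<exists>x. elts x = X"
proof -
  from assms obtain g :: "'k hs \<Rightarrow> 'k" where g: "inj_on g X"
    unfolding card_of_ordLeq[symmetric] by blast
  define f where "f k = (if k \<in> g ` X then Some (rep_hs (the_inv_into X g k)) else None)" for k
  have "children (Tree f) = rep_hs ` X"
    using g by (auto simp: f_def image_iff the_inv_into_f_f split: if_splits)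
  then have "elts (abs_hs (Tree f)) = X"
    by (simp add: elts_abs_hs image_image abs_rep_hs)
  then show ?thesis by blast
qed

definition set_of :: "'k hs set \<Rightarrow> 'k hs" where
  "set_of X = (THE x. elts x = X)"

lemma elts_set_of: "|X :: 'k hs set| \<le>o |UNIV :: 'k set| \<Longrightarrow> elts (set_of X) = X"
  unfolding set_of_def using hs_comprehension hs_extensionality by (metis (mono_tags, lifting) the_equality)

section \<open>The structures \<open>H(\<theta>)\<close> and their elementary submodels\<close>

definition trcl :: "'k hs \<Rightarrow> 'k hs set" where
  "trcl x = {y. (y, x) \<in> {(u, v). u \<in> elts v}\<^sup>+}"

text \<open>
  Cardinals are represented by cardinal orders.  A cardinal \<open>\<theta> :: 'k rel\<close> is at most \<open>|'k|\<close>,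
  so \<open>'k hs\<close> contains every set of hereditary cardinality less than \<open>\<theta>\<close>.
\<close>

definition H :: "'k rel \<Rightarrow> 'k hs set" where
  "H \<theta> = {x. |trcl x| <o \<theta>}"

text \<open>
  Formulas of the language of set theory with variables \<open>v\<^sub>0, v\<^sub>1, \<dots>\<close>, interpreted in the
  structure with domain \<open>D\<close> and true membership.
\<close>

datatype fm = Mem nat nat | Equal nat nat | Neg fm | Conj fm fm | Exists nat fm

primrec sat :: "'k hs set \<Rightarrow> fm \<Rightarrow> (nat \<Rightarrow> 'k hs) \<Rightarrow> bool" where
  "sat D (Mem i j) s \<longleftrightarrow> s i \<in> elts (s j)"
| "sat D (Equal i j) s \<longleftrightarrow> s i = s j"
| "sat D (Neg p) s \<longleftrightarrow> \<not> sat D p s"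
| "sat D (Conj p q) s \<longleftrightarrow> sat D p s \<and> sat D q s"
| "sat D (Exists i p) s \<longleftrightarrow> (\<exists>x\<in>D. sat D p (s(i := x)))"

text \<open>
  Submodels are HOL sets of elements of \<open>'k hs\<close>, since a submodel of \<open>H \<theta>\<close> (for instance
  \<open>H \<theta>\<close> itself) may be too large to be represented by an element of \<open>'k hs\<close>.
\<close>

definition elementary_submodel :: "'k rel \<Rightarrow> 'k hs set \<Rightarrow> bool" where
  "elementary_submodel \<theta> M \<longleftrightarrow> M \<noteq> {} \<and> M \<subseteq> H \<theta> \<and>
    (\<forall>p s. range s \<subseteq> M \<longrightarrow> (sat M p s \<longleftrightarrow> sat (H \<theta>) p s))"

text \<open>The relation \<open>M \<in> N\<close> between such sets.\<close>

definition set_mem :: "'k hs set \<Rightarrow> 'k hs set \<Rightarrow> bool" where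
  "set_mem M N \<longleftrightarrow> (\<exists>m\<in>N. elts m = M)"

section \<open>Grids\<close>

text \<open>
  The underlying set is an element \<open>A\<close> of the universe; the equivalence relations \<open>E i\<close>, \<open>i < n\<close>,
  are HOL relations on \<open>elts A\<close>. Values \<open>E i\<close> for \<open>i \<ge> n\<close> are irrelevant.
\<close>

definition grid :: "nat \<Rightarrow> 'k hs \<Rightarrow> (nat \<Rightarrow> 'k hs rel) \<Rightarrow> bool" where
  "grid n A E \<longleftrightarrow> (\<forall>i<n. equiv (elts A) (E i)) \<and>
    (\<forall>a\<in>elts A. \<forall>i j. i < j \<and> j < n \<longrightarrow> finite (E i `` {a} \<inter> E j `` {a}))"

definition acceptable_coloring :: "nat \<Rightarrow> 'k hs \<Rightarrow> (nat \<Rightarrow> 'k hs rel) \<Rightarrow> ('k hs \<Rightarrow> nat) \<Rightarrow> bool" where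
  "acceptable_coloring n A E \<chi> \<longleftrightarrow> \<chi> \<in> elts A \<rightarrow> {..<n} \<and>
    (\<forall>a\<in>elts A. \<forall>i<n. finite (E i `` {a} \<inter> {x \<in> elts A. \<chi> x = i}))"

definition small :: "'a set \<Rightarrow> 'a rel \<Rightarrow> 'a set \<Rightarrow> bool" where
  "small A R B \<longleftrightarrow> B \<subseteq> A \<and> (\<forall>C \<in> A // R. finite (C \<inter> B))"

text \<open>
  The grid as an element of the universe: the Kuratowski pair of \<open>A\<close> and the function
  \<open>{(i, E\<^sub>i) | i \<in> n}\<close>, where \<open>i\<close> is a von Neumann numeral and \<open>E\<^sub>i\<close> is a set of Kuratowski pairs.
\<close>

definition pair :: "'k hs \<Rightarrow> 'k hs \<Rightarrow> 'k hs" where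
  "pair x y = set_of {set_of {x}, set_of {x, y}}"

primrec num :: "nat \<Rightarrow> 'k hs" where
  "num 0 = set_of {}"
| "num (Suc i) = set_of (insert (num i) (elts (num i)))"

definition rel_code :: "'k hs rel \<Rightarrow> 'k hs" where
  "rel_code R = set_of {pair x y | x y. (x, y) \<in> R}"

definition grid_code :: "nat \<Rightarrow> 'k hs \<Rightarrow> (nat \<Rightarrow> 'k hs rel) \<Rightarrow> 'k hs" where
  "grid_code n A E = pair A (set_of {pair (num i) (rel_code (E i)) | i. i < n})"

definition test_set :: "'k rel \<Rightarrow> nat \<Rightarrow> 'k hs \<Rightarrow> (nat \<Rightarrow> 'k hs rel) \<Rightarrow> 'k hs set set \<Rightarrow> bool" where
  "test_set \<theta> n A E \<M> \<longleftrightarrow>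
    (\<forall>M\<in>\<M>. elementary_submodel \<theta> M \<and> grid_code n A E \<in> M) \<and>
    finite \<M> \<and> card \<M> = n - 1 \<and>
    strict_linear_order_on \<M> {(M, N). M \<in> \<M> \<and> N \<in> \<M> \<and> set_mem M N}"

definition twisted :: "'k rel \<Rightarrow> nat \<Rightarrow> 'k hs \<Rightarrow> (nat \<Rightarrow> 'k hs rel) \<Rightarrow> bool" where
  "twisted \<theta> n A E \<longleftrightarrow>
    (\<forall>\<M> k. test_set \<theta> n A E \<M> \<and> k < n \<longrightarrow>
      small (elts A) (E k)
        {x \<in> elts A - \<Union>\<M>. \<forall>i \<in> {..<n} - {k}. set_of (E i `` {x}) \<in> \<Union>\<M>})"

text \<open>
  \<open>\<theta>\<close> is a sufficiently large regular cardinal for \<open>A\<close>: it is regular, uncountable and larger than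
  \<open>2\<close> to the power of the size of the transitive closure of \<open>A\<close>.  If \<open>A\<close> is transitive, then
  \<open>trcl A = elts A\<close>, and for infinite \<open>A\<close> the least such \<open>\<theta>\<close> is \<open>(2\<^sup>|\<^sup>A\<^sup>|)\<^sup>+\<close>.
\<close>

definition large_regular :: "'k rel \<Rightarrow> 'k hs \<Rightarrow> bool" where
  "large_regular \<theta> A \<longleftrightarrow> Card_order \<theta> \<and> regularCard \<theta> \<and> natLeq <o \<theta> \<and> |Pow (trcl A)| <o \<theta>"

end

theory Submission
  imports Defs "HOL-Library.Countable_Set"
begin

text \<open>
  From a coloring to twistedness: the models of a test set share a code of a coloring, since by
  elementarity each model contains a code lying in all earlier models.  If \<open>[x]\<^sub>i\<close> belongs to one
  of them and \<open>x\<close> has color \<open>i\<close>, then \<open>x\<close> lies in a finite set belonging to this model, so \<open>x\<close> does.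
  Hence a point outside the models with \<open>[x]\<^sub>i\<close> covered for all \<open>i \<noteq> k\<close> has color \<open>k\<close>.

  From twistedness to a coloring: for every finite chain of models and every set \<open>B\<close> of points
  outside the chain there is a coloring of \<open>B\<close>, meeting each class \<open>[a]\<^sub>i\<close> in finitely many points
  of color \<open>i\<close>, in which no point uses a color whose class belongs to the chain.  This is proved by
  induction on \<open>|B|\<close>.  An uncountable \<open>B\<close> is filtered by an increasing sequence of smaller models;
  the points entering at a given stage are colored after the previous stage is appended to
  the chain, so that the points of a class \<open>[a]\<^sub>i\<close> with color \<open>i\<close> all enter at the stage at which
  the class does.  For countable \<open>B\<close>, twistedness handles the points with only one admissible color.
\<close>

section \<open>Formulas\<close>

instance fm :: countable
  by countable_datatype

primrec fv :: "fm \<Rightarrow> nat set" where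
  "fv (Mem i j) = {i, j}"
| "fv (Equal i j) = {i, j}"
| "fv (Neg p) = fv p"
| "fv (Conj p q) = fv p \<union> fv q"
| "fv (Exists i p) = fv p - {i}"

lemma finite_fv: "finite (fv p)"
  by (induction p) auto

lemma sat_cong:
  "(\<And>j. j \<in> fv p \<Longrightarrow> s j = s' j) \<Longrightarrow> sat D p s \<longleftrightarrow> sat D p s'"
proof (induction p arbitrary: s s')
  case (Neg p)
  then show ?case by (metis fv.simps(3) sat.simps(3))
next
  case (Conj p q)
  then show ?case by (metis UnCI fv.simps(4) sat.simps(4))
next
  case (Exists i p)
  have "sat D p (s(i := x)) \<longleftrightarrow> sat D p (s'(i := x))" for x
    using Exists.prems by (intro Exists.IH) auto
  then show ?case by simp
qed auto

text \<open>The bound variable is sent to an index outside the renamed free variables, which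
  prevents capture even when \<open>f\<close> is not injective.\<close>

lemma sat_rename: "\<exists>q. \<forall>s. sat D q s \<longleftrightarrow> sat D p (\<lambda>j. s (f j))"
proof (induction p arbitrary: f)
  case (Mem i j)
  show ?case by (rule exI[of _ "Mem (f i) (f j)"]) simp
next
  case (Equal i j)
  show ?case by (rule exI[of _ "Equal (f i) (f j)"]) simp
next
  case (Neg p)
  then show ?case by (metis sat.simps(3))
next
  case (Conj p q)
  then show ?case by (metis sat.simps(4))
next
  case (Exists i p)
  obtain k where k: "k \<notin> f ` fv p"
    using finite_fv[of p] ex_new_if_finite[OF infinite_UNIV_nat] by blast
  obtain q where q: "\<And>s. sat D q s \<longleftrightarrow> sat D p (\<lambda>j. s ((f(i := k)) j))"
    using Exists[of "f(i := k)"] by blast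
  have "sat D q (s(k := x)) \<longleftrightarrow> sat D p ((\<lambda>j. s (f j))(i := x))" for s x
    unfolding q using k by (intro sat_cong) auto
  then show ?case by (intro exI[of _ "Exists k q"]) simp
qed

section \<open>The universe of sets of hereditary cardinality less than \<open>\<theta>\<close>\<close>

lemma elts_subset_trcl: "elts x \<subseteq> trcl x"
  by (auto simp: trcl_def)

lemma trcl_mono: "y \<in> elts x \<Longrightarrow> trcl y \<subseteq> trcl x"
  by (auto simp: trcl_def intro: trancl_into_trancl)

lemma trcl_eq: "trcl x = elts x \<union> (\<Union>y\<in>elts x. trcl y)"
proof
  show "trcl x \<subseteq> elts x \<union> (\<Union>y\<in>elts x. trcl y)"
    by (auto simp: trcl_def elim: tranclE)
  show "elts x \<union> (\<Union>y\<in>elts x. trcl y) \<subseteq> trcl x"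
    using elts_subset_trcl trcl_mono by blast
qed

lemma not_mem_self: "x \<notin> elts x"
  using hs_foundation by (metis (mono_tags, lifting) case_prodI mem_Collect_eq wf_irrefl)

lemma mem_not_sym: "x \<in> elts y \<Longrightarrow> y \<notin> elts x"
  using wf_asym[OF hs_foundation] by simp

lemma mem_no_3_cycle: "x \<in> elts y \<Longrightarrow> y \<in> elts z \<Longrightarrow> z \<notin> elts x"
proof
  assume "x \<in> elts y" "y \<in> elts z" "z \<in> elts x"
  then have "(x, x) \<in> {(u, v). u \<in> elts v}\<^sup>+"
    by (metis (no_types, lifting) case_prodI mem_Collect_eq trancl.r_into_trancl trancl_into_trancl)
  then show False using wf_trancl[OF hs_foundation] by (metis wf_irrefl)
qed

locale universe =
  fixes \<theta> :: "'k rel"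
  assumes Card_order: "Card_order \<theta>"
    and regularCard: "regularCard \<theta>"
    and uncountable: "natLeq <o \<theta>"
begin

lemma infinite_Field: "\<not> finite (Field \<theta>)"
  using uncountable Card_order
  by (metis Field_natLeq card_of_Field_ordIso card_of_nat finite_iff_ordLess_natLeq
      not_ordLess_ordIso ordIso_ordLess_trans ordLess_transitive)

lemma Cinfinite: "Cinfinite \<theta>"
  using infinite_Field Card_order by (simp add: cinfinite_def)

section \<open>Arithmetic of sets of size less than \<open>\<theta>\<close>\<close>

lemma countable_less: "countable X \<Longrightarrow> |X| <o \<theta>"
  unfolding countable_def card_of_ordLeq
  using uncountable card_of_nat by (meson UNIV_I card_of_ordLeq ordIso_ordLess_trans ordLeq_ordLess_trans subset_UNIV)

lemma subset_less: "|Y| <o \<theta> \<Longrightarrow> X \<subseteq> Y \<Longrightarrow> |X| <o \<theta>"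
  by (meson card_of_mono1 ordLeq_ordLess_trans)

lemma image_less: "|X| <o \<theta> \<Longrightarrow> |f ` X| <o \<theta>"
  by (meson card_of_image ordLeq_ordLess_trans)

lemma Un_less: "|X| <o \<theta> \<Longrightarrow> |Y| <o \<theta> \<Longrightarrow> |X \<union> Y| <o \<theta>"
  using card_of_Un_ordLess_infinite_Field infinite_Field Card_order by blast

lemma UN_less: "|I| <o \<theta> \<Longrightarrow> (\<And>i. i \<in> I \<Longrightarrow> |X i| <o \<theta>) \<Longrightarrow> |\<Union>i\<in>I. X i| <o \<theta>"
  using card_of_UNION_ordLess_infinite_Field_regularCard[OF regularCard Cinfinite] by blast

lemma Times_less:
  assumes "|X| <o \<theta>" "|Y| <o \<theta>"
  shows "|X \<times> Y| <o \<theta>"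
proof -
  have "X \<times> Y = (\<Union>x\<in>X. Pair x ` Y)" by auto
  then show ?thesis using UN_less[OF assms(1)] image_less[OF assms(2)] by metis
qed

text \<open>The cardinal \<open>\<theta>\<close> is isomorphic to the cardinality of its field, a
  subset of \<open>'k\<close>. Hence comprehension is available for fewer than
  \<open>\<theta>\<close> elements.\<close>

lemma le_UNIV: "|X| <o \<theta> \<Longrightarrow> |X| \<le>o |UNIV :: 'k set|"
  using Card_order
  by (meson card_of_Field_ordIso card_of_mono1 ordIso_symmetric ordLess_imp_ordLeq
      ordLess_ordIso_trans ordLess_ordLeq_trans subset_UNIV)

lemma elts_set_of_less: "|X :: 'k hs set| <o \<theta> \<Longrightarrow> elts (set_of X) = X"
  by (simp add: elts_set_of le_UNIV)

lemma elts_set_of_finite: "finite X \<Longrightarrow> elts (set_of X :: 'k hs) = X"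
  by (simp add: elts_set_of_less countable_less countable_finite)

lemma set_of_elts: "set_of (elts x) = (x :: 'k hs)"
  by (simp add: elts_set_of card_elts hs_extensionality)

section \<open>Closure properties of \<open>H \<theta>\<close>\<close>

lemma H_transitive: "x \<in> H \<theta> \<Longrightarrow> y \<in> elts x \<Longrightarrow> y \<in> H \<theta>"
  unfolding H_def using subset_less trcl_mono by blast

lemma elts_less: "x \<in> H \<theta> \<Longrightarrow> |elts x| <o \<theta>"
  unfolding H_def using subset_less elts_subset_trcl by blast

text \<open>Regularity: the transitive closure of the new set is \<open>X\<close> together with a
  union of fewer than \<open>\<theta>\<close> sets, each of size less than
  \<open>\<theta>\<close>.\<close>

lemma set_of_in_H:
  assumes "X \<subseteq> H \<theta>" "|X| <o \<theta>"
  shows "set_of X \<in> H \<theta>"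
proof -
  have "|\<Union>y\<in>X. trcl y| <o \<theta>"
    using assms by (intro UN_less) (auto simp: H_def)
  then show ?thesis
    unfolding H_def using assms Un_less by (simp add: trcl_eq[of "set_of X"] elts_set_of_less)
qed

lemma subset_in_H: "x \<in> H \<theta> \<Longrightarrow> X \<subseteq> elts x \<Longrightarrow> set_of X \<in> H \<theta>"
  using set_of_in_H elts_less subset_less H_transitive by (meson subsetD subsetI)

lemma elts_set_of_subset: "x \<in> H \<theta> \<Longrightarrow> X \<subseteq> elts x \<Longrightarrow> elts (set_of X) = X"
  using elts_set_of_less elts_less subset_less by blast

lemma finite_set_of_in_H: "finite X \<Longrightarrow> X \<subseteq> H \<theta> \<Longrightarrow> set_of X \<in> H \<theta>"
  by (simp add: set_of_in_H countable_less countable_finite)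

section \<open>Kuratowski pairs and von Neumann numerals\<close>

lemma elts_pair: "elts (pair x y) = {set_of {x}, set_of {x, y :: 'k hs}}"
  by (simp add: pair_def elts_set_of_finite)

lemma pair_in_H: "x \<in> H \<theta> \<Longrightarrow> y \<in> H \<theta> \<Longrightarrow> pair x y \<in> H \<theta>"
  by (simp add: pair_def finite_set_of_in_H)

lemma pair_eq_iff: "pair x y = pair x' y' \<longleftrightarrow> x = x' \<and> y = (y' :: 'k hs)"
proof
  assume *: "pair x y = pair x' y'"
  have inj: "set_of X = set_of Y \<longleftrightarrow> X = Y" if "finite X" "finite Y" for X Y :: "'k hs set"
    using that elts_set_of_finite by metis
  have "{set_of {x}, set_of {x, y}} = {set_of {x'}, set_of {x', y'}}"
    using * elts_pair by metis
  then show "x = x' \<and> y = y'"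
    by (auto simp: doubleton_eq_iff inj)
qed simp

lemma elts_num: "elts (num i :: 'k hs) = num ` {..<i}"
proof (induction i)
  case (Suc i)
  have "elts (num (Suc i) :: 'k hs) = insert (num i) (elts (num i))"
    by (simp add: elts_set_of_finite Suc.IH)
  then show ?case by (simp add: Suc.IH lessThan_Suc)
qed (simp add: elts_set_of_finite)

lemma num_eq_iff: "num i = (num j :: 'k hs) \<longleftrightarrow> i = j"
proof (rule linorder_cases[of i j])
  show "i < j \<Longrightarrow> ?thesis"
    by (metis elts_num imageI lessThan_iff nat_neq_iff not_mem_self)
  show "j < i \<Longrightarrow> ?thesis"
    by (metis elts_num imageI lessThan_iff nat_neq_iff not_mem_self)
qed simp

lemma num_in_H: "num i \<in> H \<theta>"
proof (induction i rule: less_induct)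
  case (less i)
  have "num i = (set_of (num ` {..<i}) :: 'k hs)"
    by (metis elts_num set_of_elts)
  also have "\<dots> \<in> H \<theta>"
    using less by (intro finite_set_of_in_H) auto
  finally show ?case .
qed

section \<open>Definability over the universe\<close>

text \<open>
  Predicates depend on an assignment whose entries are read as de Bruijn indices;
  terms are variables or parameters from a set \<open>M\<close>.
\<close>

definition dtm :: "'k hs set \<Rightarrow> ((nat \<Rightarrow> 'k hs) \<Rightarrow> 'k hs) \<Rightarrow> bool" where
  "dtm M t \<longleftrightarrow> (\<exists>i. t = (\<lambda>s. s i)) \<or> (\<exists>c\<in>M. t = (\<lambda>s. c))"

definition dfn :: "'k hs set \<Rightarrow> ((nat \<Rightarrow> 'k hs) \<Rightarrow> bool) \<Rightarrow> bool" where
  "dfn M P \<longleftrightarrow> (\<exists>p t. (\<forall>j. dtm M (t j)) \<and>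
    (\<forall>s. range s \<subseteq> H \<theta> \<longrightarrow> (P s \<longleftrightarrow> sat (H \<theta>) p (\<lambda>j. t j s))))"

lemma dtm_var: "dtm M (\<lambda>s. s i)"
  by (auto simp: dtm_def)

lemma dtm_const: "c \<in> M \<Longrightarrow> dtm M (\<lambda>s. c)"
  by (auto simp: dtm_def)

lemma dtm_shift: "dtm M t \<Longrightarrow> dtm M (\<lambda>s. t (\<lambda>j. s (Suc j)))"
  by (auto simp: dtm_def)

lemma dtm_in_H: "dtm M t \<Longrightarrow> M \<subseteq> H \<theta> \<Longrightarrow> range s \<subseteq> H \<theta> \<Longrightarrow> t s \<in> H \<theta>"
  by (auto simp: dtm_def)

lemma dfn_cong:
  "dfn M Q \<Longrightarrow> (\<And>s. range s \<subseteq> H \<theta> \<Longrightarrow> P s \<longleftrightarrow> Q s) \<Longrightarrow> dfn M P"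
  unfolding dfn_def by simp

lemma dfn_mem: "dtm M t \<Longrightarrow> dtm M u \<Longrightarrow> dfn M (\<lambda>s. t s \<in> elts (u s))"
  unfolding dfn_def
  by (intro exI[of _ "Mem 0 1"] exI[of _ "\<lambda>j. if j = 0 then t else u"]) simp

lemma dfn_eq: "dtm M t \<Longrightarrow> dtm M u \<Longrightarrow> dfn M (\<lambda>s. t s = u s)"
  unfolding dfn_def
  by (intro exI[of _ "Equal 0 1"] exI[of _ "\<lambda>j. if j = 0 then t else u"]) simp

lemma dfn_not: "dfn M P \<Longrightarrow> dfn M (\<lambda>s. \<not> P s)"
  unfolding dfn_def by (metis sat.simps(3))

lemma dfn_conj:
  assumes "dfn M P" "dfn M Q"
  shows "dfn M (\<lambda>s. P s \<and> Q s)"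
proof -
  obtain p t where p: "\<And>j. dtm M (t j)"
      "\<And>s. range s \<subseteq> H \<theta> \<Longrightarrow> P s \<longleftrightarrow> sat (H \<theta>) p (\<lambda>j. t j s)"
    using assms(1) unfolding dfn_def by blast
  obtain q u where q: "\<And>j. dtm M (u j)"
      "\<And>s. range s \<subseteq> H \<theta> \<Longrightarrow> Q s \<longleftrightarrow> sat (H \<theta>) q (\<lambda>j. u j s)"
    using assms(2) unfolding dfn_def by blast
  obtain p' where p': "\<And>s. sat (H \<theta>) p' s \<longleftrightarrow> sat (H \<theta>) p (\<lambda>j. s (2 * j))"
    using sat_rename[of _ p "\<lambda>j. 2 * j"] by blast
  obtain q' where q': "\<And>s. sat (H \<theta>) q' s \<longleftrightarrow> sat (H \<theta>) q (\<lambda>j. s (2 * j + 1))"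
    using sat_rename[of _ q "\<lambda>j. 2 * j + 1"] by blast
  \<comment> \<open>Even positions carry the terms of \<open>p\<close> and odd positions those of
    \<open>q\<close>, so the two lists do not interfere.\<close>
  define v where "v j = (if even j then t (j div 2) else u (j div 2))" for j
  have "sat (H \<theta>) (Conj p' q') (\<lambda>j. v j s) \<longleftrightarrow> P s \<and> Q s" if "range s \<subseteq> H \<theta>" for s
    using that by (simp add: p' q' p q v_def)
  then show ?thesis
    unfolding dfn_def by (intro exI[of _ "Conj p' q'"] exI[of _ v]) (simp add: v_def p q)
qed

lemma dfn_disj: "dfn M P \<Longrightarrow> dfn M Q \<Longrightarrow> dfn M (\<lambda>s. P s \<or> Q s)"
  by (rule dfn_cong[where Q = "\<lambda>s. \<not> (\<not> P s \<and> \<not> Q s)"]) ((intro dfn_not dfn_conj; assumption), blast)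

lemma dfn_imp: "dfn M P \<Longrightarrow> dfn M Q \<Longrightarrow> dfn M (\<lambda>s. P s \<longrightarrow> Q s)"
  by (rule dfn_cong[where Q = "\<lambda>s. \<not> P s \<or> Q s"]) ((intro dfn_not dfn_disj; assumption), blast)

lemma dfn_iff: "dfn M P \<Longrightarrow> dfn M Q \<Longrightarrow> dfn M (\<lambda>s. P s \<longleftrightarrow> Q s)"
  by (rule dfn_cong[where Q = "\<lambda>s. (P s \<longrightarrow> Q s) \<and> (Q s \<longrightarrow> P s)"]) ((intro dfn_imp dfn_conj; assumption), blast)

lemma dfn_True: "M \<noteq> {} \<Longrightarrow> dfn M (\<lambda>s. True)"
  by (rule dfn_cong[OF dfn_eq[OF dtm_var dtm_var]]) auto

text \<open>The term list may mention variable 0 at many positions, whereas \<open>Exists 0\<close>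
  changes a single one. Renaming merges all these positions into position 0.\<close>

lemma dfn_isolate:
  assumes "dfn M P"
  obtains q u where "\<And>j. dtm M (u j)" and
    "\<And>x s. x \<in> H \<theta> \<Longrightarrow> range s \<subseteq> H \<theta> \<Longrightarrow>
      P (case_nat x s) \<longleftrightarrow> sat (H \<theta>) q ((\<lambda>j. u j s)(0 := x))"
proof -
  obtain p t where p: "\<And>j. dtm M (t j)"
      "\<And>s. range s \<subseteq> H \<theta> \<Longrightarrow> P s \<longleftrightarrow> sat (H \<theta>) p (\<lambda>j. t j s)"
    using assms unfolding dfn_def by blast
  define f where "f j = (if t j = (\<lambda>s. s 0) then 0 else Suc j)" for j
  \<comment> \<open>Position \<open>Suc j\<close> holds the old term \<open>j\<close> with its
    variable index lowered by one. Position 0 will be overwritten by \<open>x\<close>;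
    \<open>undefined\<close> could be read only by variable 0 itself, which is treated
    separately.\<close>
  define u where "u j = (\<lambda>s. case j of 0 \<Rightarrow> s 0
    | Suc j \<Rightarrow> if t j = (\<lambda>s. s 0) then s 0 else t j (case_nat undefined s))" for j
  obtain q where q: "\<And>s. sat (H \<theta>) q s \<longleftrightarrow> sat (H \<theta>) p (\<lambda>j. s (f j))"
    using sat_rename by blast
  show thesis
  proof
    fix j
    show "dtm M (u j)"
    proof (cases j)
      case (Suc i)
      consider k where "t i = (\<lambda>s. s k)" | c where "c \<in> M" "t i = (\<lambda>s. c)"
        using p(1)[of i] unfolding dtm_def by blast
      then show ?thesis
      proof cases
        case (1 k)
        then show ?thesis
          by (cases "t i = (\<lambda>s. s 0)"; cases k) (auto simp: u_def Suc dtm_def)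
      next
        case 2
        then show ?thesis
          by (cases "t i = (\<lambda>s. s 0)") (auto simp: u_def Suc dtm_def)
      qed
    qed (simp add: u_def dtm_var)
  next
    fix x and s :: "nat \<Rightarrow> 'k hs"
    assume "x \<in> H \<theta>" "range s \<subseteq> H \<theta>"
    then have "range (case_nat x s) \<subseteq> H \<theta>"
      by (auto simp: image_subset_iff split: nat.split)
    moreover have "((\<lambda>j. u j s)(0 := x)) (f j) = t j (case_nat x s)" for j
    proof (cases "t j = (\<lambda>s. s 0)")
      case False
      then consider k where "t j = (\<lambda>s. s (Suc k))" | c where "t j = (\<lambda>s. c)"
        using p(1)[of j] unfolding dtm_def by (metis not0_implies_Suc)
      then show ?thesis
        using False by cases (auto simp: f_def u_def)
    qed (simp add: f_def)
    ultimately show "P (case_nat x s) \<longleftrightarrow> sat (H \<theta>) q ((\<lambda>j. u j s)(0 := x))"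
      using p(2) q by presburger
  qed
qed

lemma dfn_ex:
  assumes "dfn M (\<lambda>s. Q (s 0) (\<lambda>j. s (Suc j)))"
  shows "dfn M (\<lambda>s. \<exists>x\<in>H \<theta>. Q x s)"
proof (rule dfn_isolate[OF assms])
  fix q u
  assume u: "\<And>j. dtm M (u j)" and q: "\<And>x s. x \<in> H \<theta> \<Longrightarrow> range s \<subseteq> H \<theta> \<Longrightarrow>
      Q (case_nat x s 0) (\<lambda>j. case_nat x s (Suc j)) \<longleftrightarrow> sat (H \<theta>) q ((\<lambda>j. u j s)(0 := x))"
  show ?thesis
    unfolding dfn_def using u q[simplified] by (intro exI[of _ "Exists 0 q"] exI[of _ u]) auto
qed

text \<open>Since \<open>H \<theta>\<close> is transitive, a quantifier over the elements of a term
  stays inside the domain of quantification.\<close>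

lemma dfn_bex:
  assumes "M \<subseteq> H \<theta>" "dtm M t" "dfn M (\<lambda>s. Q (s 0) (\<lambda>j. s (Suc j)))"
  shows "dfn M (\<lambda>s. \<exists>x\<in>elts (t s). Q x s)"
proof (rule dfn_cong)
  show "dfn M (\<lambda>s. \<exists>x\<in>H \<theta>. x \<in> elts (t s) \<and> Q x s)"
    using assms by (intro dfn_ex dfn_conj dfn_mem dtm_var dtm_shift)
  show "(\<exists>x\<in>elts (t s). Q x s) \<longleftrightarrow> (\<exists>x\<in>H \<theta>. x \<in> elts (t s) \<and> Q x s)"
    if "range s \<subseteq> H \<theta>" for s
    using dtm_in_H[OF assms(2,1) that] H_transitive by blast
qed

lemma dfn_all:
  "dfn M (\<lambda>s. Q (s 0) (\<lambda>j. s (Suc j))) \<Longrightarrow> dfn M (\<lambda>s. \<forall>x\<in>H \<theta>. Q x s)"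
  using dfn_not[OF dfn_ex[of M "\<lambda>x s. \<not> Q x s", OF dfn_not]] by (rule dfn_cong) auto

lemma dfn_ball:
  "M \<subseteq> H \<theta> \<Longrightarrow> dtm M t \<Longrightarrow> dfn M (\<lambda>s. Q (s 0) (\<lambda>j. s (Suc j))) \<Longrightarrow>
    dfn M (\<lambda>s. \<forall>x\<in>elts (t s). Q x s)"
  using dfn_not[OF dfn_bex[of M t "\<lambda>x s. \<not> Q x s", OF _ _ dfn_not]] by (rule dfn_cong) auto

lemma dfn_finite_ball:
  assumes "M \<noteq> {}" "finite I" "\<And>i. i \<in> I \<Longrightarrow> dfn M (P i)"
  shows "dfn M (\<lambda>s. \<forall>i\<in>I. P i s)"
  using assms(2,3)
proof (induction I rule: finite_induct)
  case (insert i I)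
  then have "dfn M (\<lambda>s. P i s \<and> (\<forall>i\<in>I. P i s))"
    by (intro dfn_conj) auto
  then show ?case by simp
qed (simp add: dfn_True assms(1))

lemma dfn_finite_bex:
  "M \<noteq> {} \<Longrightarrow> finite I \<Longrightarrow> (\<And>i. i \<in> I \<Longrightarrow> dfn M (P i)) \<Longrightarrow> dfn M (\<lambda>s. \<exists>i\<in>I. P i s)"
  by (rule dfn_cong[OF dfn_not[OF dfn_finite_ball[of M I "\<lambda>i s. \<not> P i s"]]])
    (auto intro: dfn_not)

lemmas dfn_intros = dfn_mem dfn_eq dfn_not dfn_conj dfn_disj dfn_imp dfn_iff dfn_bex dfn_ball
  dfn_ex dfn_all dfn_finite_ball dfn_finite_bex dtm_var dtm_const dtm_shift

text \<open>The members \<open>a\<close> and \<open>b\<close> of the Kuratowski pair may coincide in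
  the formula, which covers pairs with equal components.\<close>

lemma dfn_is_pair:
  assumes "M \<subseteq> H \<theta>" "dtm M t" "dtm M u" "dtm M v"
  shows "dfn M (\<lambda>s. t s = pair (u s) (v s))"
proof (rule dfn_cong)
  show "dfn M (\<lambda>s. \<exists>a\<in>elts (t s). \<exists>b\<in>elts (t s). (\<forall>z\<in>elts (t s). z = a \<or> z = b) \<and>
     u s \<in> elts a \<and> (\<forall>z\<in>elts a. z = u s) \<and>
     u s \<in> elts b \<and> v s \<in> elts b \<and> (\<forall>z\<in>elts b. z = u s \<or> z = v s))"
    using assms by (intro dfn_intros)
  fix s
  have "x = pair y z \<longleftrightarrow> (\<exists>a\<in>elts x. \<exists>b\<in>elts x. (\<forall>z\<in>elts x. z = a \<or> z = b) \<and>
      y \<in> elts a \<and> (\<forall>w\<in>elts a. w = y) \<and>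
      y \<in> elts b \<and> z \<in> elts b \<and> (\<forall>w\<in>elts b. w = y \<or> w = z))" (is "_ \<longleftrightarrow> ?R") for x y z :: "'k hs"
  proof
    assume "x = pair y z"
    then show ?R
      by (intro bexI[of _ "set_of {y}"] bexI[of _ "set_of {y, z}"])
        (auto simp: elts_pair elts_set_of_finite)
  next
    assume ?R
    then obtain a b where "elts x = {a, b}" "elts a = {y}" "elts b = {y, z}" by blast
    then have "elts x = elts (pair y z)"
      by (metis elts_pair set_of_elts)
    then show "x = pair y z" by (rule hs_extensionality)
  qed
  then show "t s = pair (u s) (v s) \<longleftrightarrow>
    (\<exists>a\<in>elts (t s). \<exists>b\<in>elts (t s). (\<forall>z\<in>elts (t s). z = a \<or> z = b) \<and>
     u s \<in> elts a \<and> (\<forall>z\<in>elts a. z = u s) \<and>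
     u s \<in> elts b \<and> v s \<in> elts b \<and> (\<forall>z\<in>elts b. z = u s \<or> z = v s))" .
qed

lemma dfn_pair_mem:
  assumes "M \<subseteq> H \<theta>" "dtm M t" "dtm M u" "dtm M v"
  shows "dfn M (\<lambda>s. pair (u s) (v s) \<in> elts (t s))"
proof (rule dfn_cong)
  show "dfn M (\<lambda>s. \<exists>p\<in>elts (t s). p = pair (u s) (v s))"
    using assms by (intro dfn_bex dfn_is_pair dfn_intros)
qed auto

end

section \<open>Elementary submodels\<close>

context universe
begin

lemma elementary_subset: "elementary_submodel \<theta> M \<Longrightarrow> M \<subseteq> H \<theta>"
  and elementary_nonempty: "elementary_submodel \<theta> M \<Longrightarrow> M \<noteq> {}"
  by (auto simp: elementary_submodel_def)

text \<open>The Tarski-Vaught property, phrased for \<open>dfn\<close> predicates instead of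
  formulas. Later uses of elementarity pass through it.\<close>

lemma elementary_ex:
  assumes M: "elementary_submodel \<theta> M" and Q: "dfn M (\<lambda>s. Q (s 0))"
    and ex: "\<exists>x\<in>H \<theta>. Q x"
  shows "\<exists>x\<in>M. Q x"
proof (rule dfn_isolate[OF Q])
  fix q u
  assume u: "\<And>j. dtm M (u j)" and q: "\<And>x s. x \<in> H \<theta> \<Longrightarrow> range s \<subseteq> H \<theta> \<Longrightarrow>
      Q (case_nat x s 0) \<longleftrightarrow> sat (H \<theta>) q ((\<lambda>j. u j s)(0 := x))"
  obtain c where c: "c \<in> M"
    using M elementary_nonempty by blast
  \<comment> \<open>The predicate looks at \<open>s 0\<close> only, so the rest of the environment
    can be filled with any \<open>c\<close> from \<open>M\<close>; all parameters then have values
    in \<open>M\<close>.\<close>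
  define e where "e = (\<lambda>j. u j (\<lambda>_. c))"
  have e: "range e \<subseteq> M"
  proof (rule image_subsetI)
    fix j
    show "e j \<in> M"
      using u[of j] c by (auto simp: e_def dtm_def)
  qed
  have q': "Q x \<longleftrightarrow> sat (H \<theta>) q (e(0 := x))" if "x \<in> H \<theta>" for x
    using q[of x "\<lambda>_. c"] that c elementary_subset[OF M] by (auto simp: e_def)
  have "sat (H \<theta>) (Exists 0 q) e"
    using ex q' by auto
  then have "sat M (Exists 0 q) e"
    using M e unfolding elementary_submodel_def by blast
  then obtain x where x: "x \<in> M" "sat M q (e(0 := x))"
    by auto
  then have "range (e(0 := x)) \<subseteq> M"
    using e by auto
  then have "sat (H \<theta>) q (e(0 := x))"
    using M x(2) unfolding elementary_submodel_def by blast
  then show ?thesis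
    using q' x(1) elementary_subset[OF M] by blast
qed

text \<open>Elementarity gives some solution in \<open>M\<close>, and uniqueness identifies it with
  \<open>a\<close>. This is how definable sets are shown to belong to \<open>M\<close>.\<close>

lemma elementary_unique:
  assumes "elementary_submodel \<theta> M" "dfn M (\<lambda>s. Q (s 0))"
    and "a \<in> H \<theta>" "Q a" "\<And>x. x \<in> H \<theta> \<Longrightarrow> Q x \<Longrightarrow> x = a"
  shows "a \<in> M"
  using elementary_ex[of M Q] assms elementary_subset by blast

lemma elementary_separation:
  assumes M: "elementary_submodel \<theta> M" "C \<in> M" "dfn M (\<lambda>s. Q (s 0))"
  shows "set_of {y \<in> elts C. Q y} \<in> M"
proof (rule elementary_unique[OF M(1)])
  have C: "C \<in> H \<theta>"
    using M elementary_subset by blast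
  have elts: "elts (set_of {y \<in> elts C. Q y}) = {y \<in> elts C. Q y}"
    by (rule elts_set_of_subset[OF C]) auto
  show "dfn M (\<lambda>s. (\<forall>y\<in>elts (s 0). y \<in> elts C) \<and> (\<forall>y\<in>elts C. y \<in> elts (s 0) \<longleftrightarrow> Q y))"
    using M elementary_subset by (intro dfn_intros) auto
  show "set_of {y \<in> elts C. Q y} \<in> H \<theta>"
    by (rule subset_in_H[OF C]) auto
  show "(\<forall>y\<in>elts (set_of {y \<in> elts C. Q y}). y \<in> elts C) \<and>
      (\<forall>y\<in>elts C. y \<in> elts (set_of {y \<in> elts C. Q y}) \<longleftrightarrow> Q y)"
    by (simp add: elts)
  show "x = set_of {y \<in> elts C. Q y}"
    if "(\<forall>y\<in>elts x. y \<in> elts C) \<and> (\<forall>y\<in>elts C. y \<in> elts x \<longleftrightarrow> Q y)" for x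
    using that elts by (intro hs_extensionality) auto
qed

text \<open>Induction on the number of elements: elementarity finds one element in \<open>M\<close>,
  and separation removes it without leaving \<open>M\<close>.\<close>

lemma elementary_finite_subset:
  assumes M: "elementary_submodel \<theta> M"
  shows "F \<in> M \<Longrightarrow> finite (elts F) \<Longrightarrow> elts F \<subseteq> M"
proof (induction "card (elts F)" arbitrary: F)
  case (Suc m)
  note MH = elementary_subset[OF M]
  have "dfn M (\<lambda>s. s 0 \<in> elts F)"
    using Suc.prems by (intro dfn_intros)
  then have "\<exists>x\<in>M. x \<in> elts F"
  proof (rule elementary_ex[OF M])
    show "\<exists>x\<in>H \<theta>. x \<in> elts F"
      using Suc MH H_transitive by (metis all_not_in_conv card.empty nat.distinct(1) subsetD)
  qed
  then obtain x where x: "x \<in> M" "x \<in> elts F" by blast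
  define G where "G = set_of {y \<in> elts F. y \<noteq> x}"
  have "dfn M (\<lambda>s. s 0 \<noteq> x)"
    using x by (intro dfn_intros)
  then have "G \<in> M"
    unfolding G_def using Suc.prems by (intro elementary_separation[OF M])
  moreover have "elts G = elts F - {x}"
    unfolding G_def using Suc.prems MH by (subst elts_set_of_subset[of F]) auto
  moreover have "card (elts F - {x}) = m"
    using Suc.hyps(2) x(2) by (simp add: card_Diff_singleton_if)
  ultimately have "elts F - {x} \<subseteq> M"
    using Suc.hyps(1)[of G] Suc.prems by (metis finite_Diff)
  then show ?case using x by blast
qed simp

text \<open>Separation puts the set into \<open>M\<close>, and finiteness then puts its elements
  there. \<open>model_Int_classes\<close>, \<open>not_all_covered\<close> and
  \<open>coloring_code_in_model\<close> trap a point in a model this way.\<close>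

lemma elementary_finite_separation:
  assumes M: "elementary_submodel \<theta> M" "C \<in> M" "dfn M (\<lambda>s. Q (s 0))"
    and fin: "finite {y \<in> elts C. Q y}"
  shows "{y \<in> elts C. Q y} \<subseteq> M"
proof -
  have "elts (set_of {y \<in> elts C. Q y}) = {y \<in> elts C. Q y}"
    using fin by (rule elts_set_of_finite)
  then show ?thesis
    using elementary_finite_subset[OF M(1) elementary_separation[OF M]] fin by simp
qed

lemma pair_in_H_D:
  assumes "pair x y \<in> H \<theta>"
  shows "x \<in> H \<theta>" "y \<in> H \<theta>"
proof -
  have "set_of {x, y} \<in> H \<theta>"
    using assms H_transitive[of "pair x y"] by (simp add: elts_pair)
  then show "x \<in> H \<theta>" "y \<in> H \<theta>"
    using H_transitive[of "set_of {x, y}"] by (auto simp: elts_set_of_finite)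
qed

lemma elementary_pair_D:
  assumes M: "elementary_submodel \<theta> M" and p: "pair x y \<in> M"
  shows "x \<in> M" "y \<in> M"
proof -
  note MH = elementary_subset[OF M]
  have H: "x \<in> H \<theta>" "y \<in> H \<theta>"
    using pair_in_H_D p MH by blast+
  show "x \<in> M"
  proof (rule elementary_unique[OF M _ H(1)])
    show "dfn M (\<lambda>s. \<exists>z\<in>H \<theta>. pair x y = pair (s 0) z)"
      using p MH by (intro dfn_ex dfn_is_pair dfn_intros)
  qed (use H in \<open>auto simp: pair_eq_iff\<close>)
  show "y \<in> M"
  proof (rule elementary_unique[OF M _ H(2)])
    show "dfn M (\<lambda>s. \<exists>z\<in>H \<theta>. pair x y = pair z (s 0))"
      using p MH by (intro dfn_ex dfn_is_pair dfn_intros)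
  qed (use H in \<open>auto simp: pair_eq_iff\<close>)
qed

lemma elementary_num:
  assumes M: "elementary_submodel \<theta> M"
  shows "num i \<in> M"
proof (induction i)
  note MH = elementary_subset[OF M]
  case 0
  show ?case
  proof (rule elementary_unique[OF M _ num_in_H])
    show "dfn M (\<lambda>s. \<forall>z\<in>elts (s 0). z \<noteq> z)"
      using MH by (intro dfn_intros)
  qed (auto simp del: num.simps simp: elts_num intro!: hs_extensionality)
next
  note MH = elementary_subset[OF M]
  case (Suc i)
  have elts: "elts (num (Suc i) :: 'k hs) = insert (num i) (elts (num i))"
    by (simp add: elts_num lessThan_Suc del: num.simps)
  show ?case
  proof (rule elementary_unique[OF M _ num_in_H])
    show "dfn M (\<lambda>s. num i \<in> elts (s 0) \<and> (\<forall>z\<in>elts (num i). z \<in> elts (s 0)) \<and>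
        (\<forall>z\<in>elts (s 0). z = num i \<or> z \<in> elts (num i)))"
      using MH Suc by (intro dfn_intros)
    show "x = num (Suc i)" if "num i \<in> elts x \<and> (\<forall>z\<in>elts (num i). z \<in> elts x) \<and>
        (\<forall>z\<in>elts x. z = num i \<or> z \<in> elts (num i))" for x :: "'k hs"
    proof -
      have "elts x = elts (num (Suc i))"
        unfolding elts using that by blast
      then show ?thesis by (rule hs_extensionality)
    qed
  qed (simp_all add: elts del: num.simps)
qed

end

section \<open>Grids\<close>

locale grid_universe = universe \<theta> for \<theta> :: "'k rel" +
  fixes n :: nat and A :: "'k hs" and E :: "nat \<Rightarrow> 'k hs rel"
  assumes grid: "grid n A E"
    and A_in_H: "A \<in> H \<theta>"
begin

lemma equiv_E: "i < n \<Longrightarrow> equiv (elts A) (E i)"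
  using grid by (simp add: grid_def)

lemma E_subset: "i < n \<Longrightarrow> E i \<subseteq> elts A \<times> elts A"
  using equiv_E equiv_type by blast

lemma refl_E: "i < n \<Longrightarrow> x \<in> elts A \<Longrightarrow> (x, x) \<in> E i"
  using equiv_E by (meson equiv_class_self Image_singleton_iff)

lemma sym_E: "i < n \<Longrightarrow> (x, y) \<in> E i \<Longrightarrow> (y, x) \<in> E i"
  using equiv_E by (meson equivE symE)

lemma finite_Int_classes:
  assumes "a \<in> elts A" "i < n" "j < n" "i \<noteq> j"
  shows "finite (E i `` {a} \<inter> E j `` {a})"
proof (cases "i < j")
  case True
  then show ?thesis using grid assms unfolding grid_def by blast
next
  case False
  then have "finite (E j `` {a} \<inter> E i `` {a})"
    using grid assms unfolding grid_def by (metis nat_neq_iff)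
  then show ?thesis by (simp add: Int_commute)
qed

text \<open>The code is meaningful only if the relation is small enough for \<open>set_of\<close>;
  this holds because the product of \<open>elts A\<close> with itself has fewer than
  \<open>\<theta>\<close> elements.\<close>

lemma rel_code:
  assumes "R \<subseteq> elts A \<times> elts A"
  shows "rel_code R \<in> H \<theta>" "pair x y \<in> elts (rel_code R) \<longleftrightarrow> (x, y) \<in> R"
proof -
  have eq: "{pair x y | x y. (x, y) \<in> R} = (\<lambda>(x, y). pair x y) ` R" by auto
  have less: "|(\<lambda>(x, y). pair x y) ` R| <o \<theta>"
    using assms elts_less[OF A_in_H] Times_less subset_less by (intro image_less) blast
  show "rel_code R \<in> H \<theta>"
    unfolding rel_code_def eq using assms H_transitive[OF A_in_H]
    by (intro set_of_in_H less) (auto intro!: pair_in_H)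
  show "pair x y \<in> elts (rel_code R) \<longleftrightarrow> (x, y) \<in> R"
    unfolding rel_code_def eq by (subst elts_set_of_less[OF less]) (auto simp: pair_eq_iff)
qed

definition model :: "'k hs set \<Rightarrow> bool" where
  "model M \<longleftrightarrow> elementary_submodel \<theta> M \<and> grid_code n A E \<in> M"

lemma model_elementary: "model M \<Longrightarrow> elementary_submodel \<theta> M"
  by (simp add: model_def)

lemma model_subset: "model M \<Longrightarrow> M \<subseteq> H \<theta>"
  using model_elementary elementary_subset by blast

lemma model_nonempty: "model M \<Longrightarrow> M \<noteq> {}"
  using model_elementary elementary_nonempty by blast

lemma grid_code_in_H: "grid_code n A E \<in> H \<theta>"
proof -
  have eq: "{pair (num i) (rel_code (E i)) | i. i < n} = (\<lambda>i. pair (num i) (rel_code (E i))) ` {..<n}"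
    by auto
  show ?thesis
    unfolding grid_code_def eq using E_subset
    by (intro pair_in_H A_in_H finite_set_of_in_H) (auto intro!: pair_in_H num_in_H rel_code)
qed

lemma model_A: "model M \<Longrightarrow> A \<in> M"
  unfolding model_def grid_code_def using elementary_pair_D by blast

lemma model_rel_code:
  assumes M: "model M" and i: "i < n"
  shows "rel_code (E i) \<in> M"
proof -
  let ?f = "set_of {pair (num i) (rel_code (E i)) | i. i < n}"
  have f: "?f \<in> M"
    using M unfolding model_def grid_code_def using elementary_pair_D by blast
  have eq: "{pair (num i) (rel_code (E i)) | i. i < n} = (\<lambda>i. pair (num i) (rel_code (E i))) ` {..<n}"
    by auto
  have elts: "elts ?f = (\<lambda>i. pair (num i) (rel_code (E i))) ` {..<n}"
    unfolding eq by (simp add: elts_set_of_finite)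
  show ?thesis
  proof (rule elementary_unique[OF model_elementary[OF M] _ rel_code(1)[OF E_subset[OF i]]])
    show "dfn M (\<lambda>s. pair (num i) (s 0) \<in> elts ?f)"
      using model_subset[OF M] f elementary_num[OF model_elementary[OF M]]
      by (intro dfn_pair_mem dfn_intros)
  qed (use i in \<open>auto simp: elts pair_eq_iff num_eq_iff\<close>)
qed

lemma dfn_E:
  assumes "model M" "i < n" "dtm M t" "dtm M u"
  shows "dfn M (\<lambda>s. (t s, u s) \<in> E i)"
  using dfn_pair_mem[OF model_subset dtm_const[OF model_rel_code], of M i t u] assms
  by (simp add: rel_code[OF E_subset])

section \<open>Equivalence classes as elements of the universe\<close>

definition cls :: "nat \<Rightarrow> 'k hs \<Rightarrow> 'k hs" where
  "cls i x = set_of (E i `` {x})"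

lemma cls_subset: "i < n \<Longrightarrow> E i `` {x} \<subseteq> elts A"
  using E_subset by blast

lemma elts_cls: "i < n \<Longrightarrow> elts (cls i x) = E i `` {x}"
  unfolding cls_def by (rule elts_set_of_subset[OF A_in_H cls_subset])

lemma cls_in_H: "i < n \<Longrightarrow> cls i x \<in> H \<theta>"
  unfolding cls_def by (rule subset_in_H[OF A_in_H cls_subset])

lemma cls_eq: "i < n \<Longrightarrow> (x, y) \<in> E i \<Longrightarrow> cls i x = cls i y"
  unfolding cls_def using equiv_E by (metis equiv_class_eq)

text \<open>Equality with a class is unfolded into quantifiers bounded by \<open>C\<close> and
  \<open>A\<close>, the form from which \<open>dfn_cls\<close> reads off definability.\<close>

lemma cls_eq_iff: "i < n \<Longrightarrow> C = cls i x \<longleftrightarrow>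
    (\<forall>z\<in>elts C. (x, z) \<in> E i) \<and> (\<forall>z\<in>elts A. (x, z) \<in> E i \<longrightarrow> z \<in> elts C)"
proof -
  assume i: "i < n"
  have "C = cls i x \<longleftrightarrow> elts C = E i `` {x}"
    using elts_cls[OF i] hs_extensionality by metis
  then show ?thesis
    using E_subset[OF i] by blast
qed

lemma dfn_cls:
  assumes "model M" "i < n" "dtm M t" "dtm M u"
  shows "dfn M (\<lambda>s. t s = cls i (u s))"
  unfolding cls_eq_iff[OF assms(2)]
  using assms model_subset[OF assms(1)] model_A[OF assms(1)]
  by (intro dfn_E dfn_intros)

lemma cls_in_model:
  assumes "model M" "i < n" "x \<in> M"
  shows "cls i x \<in> M"
  by (rule elementary_unique[of M "\<lambda>y. y = cls i x"])
    (use assms in \<open>auto intro: model_elementary cls_in_H dfn_cls dtm_var dtm_const\<close>)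

text \<open>The intersection of the two classes is finite and definable from them, so all its
  points, among them \<open>x\<close>, lie in \<open>M\<close>.\<close>

lemma model_Int_classes:
  assumes M: "model M" and x: "x \<in> elts A" and ij: "i < n" "j < n" "i \<noteq> j"
    and cls: "cls i x \<in> M" "cls j x \<in> M"
  shows "x \<in> M"
proof -
  have "dfn M (\<lambda>s. s 0 \<in> elts (cls j x))"
    using cls by (intro dfn_intros)
  then have "{y \<in> elts (cls i x). y \<in> elts (cls j x)} \<subseteq> M"
    using finite_Int_classes[OF x ij] elts_cls ij
    by (intro elementary_finite_separation[OF model_elementary[OF M] cls(1)]) (auto simp: Int_def)
  then show ?thesis
    using refl_E x ij elts_cls by auto
qed

section \<open>Chains of models\<close>

text \<open>A chain lists its models as elements of the universe; transitivity of membership follows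
  from foundation.\<close>

definition chain :: "'k hs set \<Rightarrow> bool" where
  "chain Ms \<longleftrightarrow> finite Ms \<and> Ms \<subseteq> H \<theta> \<and> (\<forall>m\<in>Ms. model (elts m)) \<and>
    (\<forall>m\<in>Ms. \<forall>m'\<in>Ms. m = m' \<or> m \<in> elts m' \<or> m' \<in> elts m)"

lemma chain_subset: "chain Ms \<Longrightarrow> Ms' \<subseteq> Ms \<Longrightarrow> chain Ms'"
  unfolding chain_def by (meson finite_subset subset_iff)

lemma set_mem_elts: "set_mem (elts m) N \<longleftrightarrow> m \<in> N"
  unfolding set_mem_def using hs_extensionality by blast

lemma chain_trans:
  assumes "chain Ms" "a \<in> Ms" "b \<in> Ms" "c \<in> Ms" "a \<in> elts b" "b \<in> elts c"
  shows "a \<in> elts c"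
proof -
  have "a = c \<or> a \<in> elts c \<or> c \<in> elts a"
    using assms(1-4) unfolding chain_def by blast
  then show ?thesis
    using assms(5,6) mem_not_sym mem_no_3_cycle by metis
qed

lemma chain_max:
  assumes "chain Ms" "Ms \<noteq> {}"
  shows "\<exists>m\<in>Ms. \<forall>m'\<in>Ms. m' = m \<or> m' \<in> elts m"
proof -
  have "transp_on Ms (\<lambda>a b. a \<in> elts b)"
    using chain_trans[OF assms(1)] by (intro transp_onI) blast
  moreover have "totalp_on Ms (\<lambda>a b. a \<in> elts b)"
    using assms(1) unfolding chain_def by (intro totalp_onI) blast
  ultimately show ?thesis
    using Finite_Set.bex_greatest_element[of Ms] assms unfolding chain_def by metis
qed

text \<open>By extensionality \<open>elts\<close> is injective, so passing to HOL sets preserves the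
  number of models and turns membership into \<open>set_mem\<close>.\<close>

lemma chain_test_set:
  assumes Ms: "chain Ms" "card Ms = n - 1"
  shows "test_set \<theta> n A E (elts ` Ms)"
proof -
  have inj: "inj_on elts Ms"
    by (meson inj_onI hs_extensionality)
  let ?R = "{(M, N). M \<in> elts ` Ms \<and> N \<in> elts ` Ms \<and> set_mem M N}"
  have "trans ?R"
  proof (rule transI)
    fix M N P
    assume "(M, N) \<in> ?R" "(N, P) \<in> ?R"
    then obtain a b c where abc: "a \<in> Ms" "b \<in> Ms" "c \<in> Ms" "M = elts a" "N = elts b" "P = elts c"
      "a \<in> elts b" "b \<in> elts c"
      by (auto simp: set_mem_elts)
    have "a \<in> elts c"
      using chain_trans[OF Ms(1)] abc by blast
    then show "(M, P) \<in> ?R"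
      using abc by (auto simp: set_mem_elts)
  qed
  moreover have "irrefl ?R"
    by (auto simp: irrefl_def set_mem_elts not_mem_self)
  moreover have "total_on (elts ` Ms) ?R"
    using Ms(1) by (auto simp: total_on_def set_mem_elts chain_def)
  ultimately show ?thesis
    using Ms unfolding test_set_def strict_linear_order_on_def
    by (auto simp: chain_def model_def card_image[OF inj])
qed

text \<open>The set from the definition of \<open>twisted\<close>, but for chains of any
  length.\<close>

definition almost_covered :: "nat \<Rightarrow> 'k hs set \<Rightarrow> 'k hs set" where
  "almost_covered k Ms = {x \<in> elts A - \<Union>(elts ` Ms).
     \<forall>i\<in>{..<n} - {k}. cls i x \<in> \<Union>(elts ` Ms)}"

text \<open>A model containing two classes of \<open>x\<close> for different relations would contain
  \<open>x\<close> by \<open>model_Int_classes\<close>, but \<open>x\<close> lies outside all models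
  of the chain.\<close>

lemma class_choice_inj:
  assumes Ms: "chain Ms" and x: "x \<in> elts A - \<Union>(elts ` Ms)"
    and g: "I \<subseteq> {..<n}" "\<And>i. i \<in> I \<Longrightarrow> g i \<in> Ms \<and> cls i x \<in> elts (g i)"
  shows "inj_on g I"
proof (rule inj_onI, rule ccontr)
  fix i j
  assume ij: "i \<in> I" "j \<in> I" "g i = g j" "i \<noteq> j"
  have "x \<in> elts (g i)"
  proof (rule model_Int_classes)
    show "model (elts (g i))"
      using g(2)[OF ij(1)] Ms by (simp add: chain_def)
    show "cls i x \<in> elts (g i)" "cls j x \<in> elts (g i)"
      using g(2)[OF ij(1)] g(2)[OF ij(2)] ij(3) by simp_all
    show "i < n" "j < n" "i \<noteq> j" "x \<in> elts A"
      using ij g(1) x by auto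
  qed
  then show False using x g(2)[OF ij(1)] by blast
qed

section \<open>Consequences of twistedness for chains\<close>

context
  assumes twisted: "twisted \<theta> n A E"
begin

lemma almost_covered_small_test_set:
  assumes "chain Ms" "card Ms = n - 1" "k < n" "a \<in> elts A"
  shows "finite (E k `` {a} \<inter> almost_covered k Ms)"
proof -
  have "small (elts A) (E k) (almost_covered k Ms)"
    using twisted chain_test_set[OF assms(1,2)] assms(3)
    unfolding twisted_def almost_covered_def cls_def by blast
  then show ?thesis
    using assms(4) unfolding small_def by (meson quotientI)
qed

text \<open>Choosing for each \<open>i\<close> other than \<open>k\<close> a model that contains the
  class of \<open>x\<close> uses \<open>n - 1\<close> distinct models. So the set is covered by the
  almost covered sets of the finitely many subchains of that length, which are test sets.\<close>

lemma almost_covered_small: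
  assumes Ms: "chain Ms" and k: "k < n" and a: "a \<in> elts A"
  shows "finite (E k `` {a} \<inter> almost_covered k Ms)"
proof -
  let ?T = "{Ns. Ns \<subseteq> Ms \<and> card Ns = n - 1}"
  have "almost_covered k Ms \<subseteq> (\<Union>Ns\<in>?T. almost_covered k Ns)"
  proof
    fix x
    assume x: "x \<in> almost_covered k Ms"
    then have "\<forall>i\<in>{..<n} - {k}. \<exists>m\<in>Ms. cls i x \<in> elts m"
      by (simp add: almost_covered_def)
    then obtain g where g: "\<And>i. i \<in> {..<n} - {k} \<Longrightarrow> g i \<in> Ms \<and> cls i x \<in> elts (g i)"
      by metis
    have "inj_on g ({..<n} - {k})"
      using Ms x g by (intro class_choice_inj) (auto simp: almost_covered_def)
    then have "card (g ` ({..<n} - {k})) = n - 1"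
      using k by (simp add: card_image)
    moreover have "g ` ({..<n} - {k}) \<subseteq> Ms"
      using g by blast
    moreover have "x \<in> almost_covered k (g ` ({..<n} - {k}))"
    proof -
      have "x \<in> elts A" "x \<notin> \<Union>(elts ` g ` ({..<n} - {k}))"
        using x \<open>g ` ({..<n} - {k}) \<subseteq> Ms\<close> unfolding almost_covered_def by auto
      moreover have "\<forall>i\<in>{..<n} - {k}. cls i x \<in> \<Union>(elts ` g ` ({..<n} - {k}))"
        using g by blast
      ultimately show ?thesis
        unfolding almost_covered_def by simp
    qed
    ultimately show "x \<in> (\<Union>Ns\<in>?T. almost_covered k Ns)" by blast
  qed
  then have "E k `` {a} \<inter> almost_covered k Ms \<subseteq> (\<Union>Ns\<in>?T. E k `` {a} \<inter> almost_covered k Ns)"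
    by blast
  moreover have "finite (\<Union>Ns\<in>?T. E k `` {a} \<inter> almost_covered k Ns)"
  proof (rule finite_UN_I)
    show "finite ?T"
      using Ms by (simp add: chain_def)
    show "finite (E k `` {a} \<inter> almost_covered k Ns)" if "Ns \<in> ?T" for Ns
      using that k a chain_subset[OF Ms] by (intro almost_covered_small_test_set) auto
  qed
  ultimately show ?thesis by (rule finite_subset)
qed

text \<open>Otherwise \<open>n\<close> distinct models are chosen, one for each class of
  \<open>x\<close>. Twistedness for all but the last makes a finite set containing \<open>x\<close>
  that is definable in the last model, which therefore contains \<open>x\<close>.\<close>

lemma not_all_covered:
  assumes Ms: "chain Ms" and x: "x \<in> elts A - \<Union>(elts ` Ms)" and n: "n > 0"
  shows "\<exists>i<n. cls i x \<notin> \<Union>(elts ` Ms)"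
proof (rule ccontr)
  assume "\<not> ?thesis"
  then have "\<forall>i\<in>{..<n}. \<exists>m\<in>Ms. cls i x \<in> elts m" by simp
  then obtain g where g: "\<And>i. i \<in> {..<n} \<Longrightarrow> g i \<in> Ms \<and> cls i x \<in> elts (g i)"
    by metis
  have inj: "inj_on g {..<n}"
    using Ms x g by (intro class_choice_inj) auto
  have "chain (g ` {..<n})"
    using Ms g by (intro chain_subset[OF Ms]) auto
  \<comment> \<open>\<open>g k\<close> is the last chosen model; the others are its elements and can
    serve as parameters in it.\<close>
  then obtain k where k: "k < n" "\<And>i. i < n \<Longrightarrow> g i = g k \<or> g i \<in> elts (g k)"
    using chain_max[of "g ` {..<n}"] n by auto
  define L where "L = g ` ({..<n} - {k})"
  have LMs: "L \<subseteq> Ms" and finL: "finite L" and cardL: "card L = n - 1"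
    using g k(1) inj unfolding L_def by (auto simp: card_image inj_on_diff)
  have Lg: "L \<subseteq> elts (g k)"
    using k inj unfolding L_def inj_on_def by (metis DiffD1 DiffD2 image_subsetI insertI1 lessThan_iff)
  have gk: "model (elts (g k))"
    using Ms g k(1) by (auto simp: chain_def)
  have dfn: "dfn (elts (g k)) (\<lambda>s. (\<forall>m\<in>L. s 0 \<notin> elts m) \<and>
      (\<forall>i\<in>{..<n} - {k}. \<exists>m\<in>L. \<exists>c\<in>elts m. c = cls i (s 0)))"
    using finL Lg gk model_subset[OF gk] model_nonempty[OF gk]
    by (intro dfn_cls dfn_intros) auto
  have eq: "{y \<in> elts (cls k x). (\<forall>m\<in>L. y \<notin> elts m) \<and>
      (\<forall>i\<in>{..<n} - {k}. \<exists>m\<in>L. \<exists>c\<in>elts m. c = cls i y)} = E k `` {x} \<inter> almost_covered k L"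
    using cls_subset[OF k(1), of x] unfolding elts_cls[OF k(1)] almost_covered_def by auto
  have "finite (E k `` {x} \<inter> almost_covered k L)"
    using x k(1) chain_subset[OF Ms LMs] cardL by (intro almost_covered_small_test_set) auto
  then have "E k `` {x} \<inter> almost_covered k L \<subseteq> elts (g k)"
    using elementary_finite_separation[OF model_elementary[OF gk] _ dfn, of "cls k x"]
    unfolding eq using g k(1) by blast
  moreover have "x \<in> E k `` {x} \<inter> almost_covered k L"
  proof -
    have "x \<notin> \<Union>(elts ` L)"
      using x LMs by blast
    moreover have "\<forall>i\<in>{..<n} - {k}. cls i x \<in> \<Union>(elts ` L)"
      using g unfolding L_def by blast
    ultimately have "x \<in> almost_covered k L"
      using x unfolding almost_covered_def by simp
    then show ?thesis using refl_E[OF k(1)] x by blast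
  qed
  ultimately show False using x g k(1) by blast
qed

end

end

section \<open>Skolem hulls\<close>

lemma card_of_finite_ordLess_infinite:
  "finite X \<Longrightarrow> infinite Y \<Longrightarrow> |X| <o |Y|"
  using finite_ordLess_infinite[OF card_of_Well_order card_of_Well_order]
  by (simp add: Field_card_of)

text \<open>Infinite cardinals absorb products, so each fixed length contributes at most
  \<open>|Z|\<close> lists, and there are countably many lengths.\<close>

lemma card_of_lists_ordLeq:
  assumes "|T| \<le>o |Z|" "\<not> finite Z"
  shows "|lists T| \<le>o |Z|"
proof -
  have len: "|{xs \<in> lists T. length xs = m}| \<le>o |Z|" for m
  proof (induction m)
    case 0
    have "{xs \<in> lists T. length xs = 0} = {[]}" by auto
    then show ?case
      using assms(2) by (metis card_of_ordLeq_finite card_of_singl_ordLeq finite.emptyI)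
  next
    case (Suc m)
    let ?S = "{xs \<in> lists T. length xs = m}"
    have "{xs \<in> lists T. length xs = Suc m} \<subseteq> (\<lambda>(x, xs). x # xs) ` (T \<times> ?S)"
      by (auto simp: length_Suc_conv image_iff)
    moreover have "|T \<times> ?S| \<le>o |Z|"
      using assms Suc by (intro card_of_Times_ordLeq_infinite_Field) (auto simp: Field_card_of card_of_card_order_on)
    ultimately show ?case
      by (meson card_of_image card_of_mono1 ordLeq_transitive)
  qed
  have "lists T = (\<Union>m. {xs \<in> lists T. length xs = m})" by auto
  moreover have "|\<Union>m. {xs \<in> lists T. length xs = m}| \<le>o |Z|"
    using assms(2) len infinite_iff_card_of_nat by (intro card_of_UNION_ordLeq_infinite) auto
  ultimately show ?thesis by metis
qed

context universe
begin

text \<open>Finite lists keep the Skolem functions finitary, on which both the size bound and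
  \<open>hull_finitary\<close> depend. \<open>hull_witness\<close> uses lists covering all free
  variables, so the default value is harmless.\<close>

definition assignment :: "'k hs list \<Rightarrow> nat \<Rightarrow> 'k hs" where
  "assignment xs = (\<lambda>j. if j < length xs then xs ! j else undefined)"

definition skolem :: "fm \<Rightarrow> nat \<Rightarrow> 'k hs list \<Rightarrow> 'k hs" where
  "skolem p i xs = (SOME x. x \<in> H \<theta> \<and> sat (H \<theta>) p ((assignment xs)(i := x)))"

inductive_set hull :: "'k hs set \<Rightarrow> 'k hs set" for X where
  base: "x \<in> X \<Longrightarrow> x \<in> hull X"
| step: "\<forall>x\<in>set xs. x \<in> hull X \<Longrightarrow> \<exists>x\<in>H \<theta>. sat (H \<theta>) p ((assignment xs)(i := x)) \<Longrightarrow>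
    skolem p i xs \<in> hull X"

lemma subset_hull: "X \<subseteq> hull X"
  by (auto intro: hull.base)

lemma hull_mono:
  assumes "X \<subseteq> Y"
  shows "hull X \<subseteq> hull Y"
proof
  fix x
  assume "x \<in> hull X"
  then show "x \<in> hull Y"
    using assms by (induction rule: hull.induct) (auto intro: hull.intros)
qed

lemma skolem:
  assumes "\<exists>x\<in>H \<theta>. sat (H \<theta>) p ((assignment xs)(i := x))"
  shows "skolem p i xs \<in> H \<theta>" "sat (H \<theta>) p ((assignment xs)(i := skolem p i xs))"
proof -
  have "\<exists>x. x \<in> H \<theta> \<and> sat (H \<theta>) p ((assignment xs)(i := x))"
    using assms by blast
  from someI_ex[OF this] show "skolem p i xs \<in> H \<theta>"
    "sat (H \<theta>) p ((assignment xs)(i := skolem p i xs))"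
    unfolding skolem_def by blast+
qed

lemma hull_subset_H:
  assumes "X \<subseteq> H \<theta>"
  shows "hull X \<subseteq> H \<theta>"
proof
  fix x
  assume "x \<in> hull X"
  then show "x \<in> H \<theta>"
    using assms by (induction rule: hull.induct) (auto intro: skolem)
qed

lemma hull_witness:
  assumes s: "range s \<subseteq> hull X" and ex: "\<exists>x\<in>H \<theta>. sat (H \<theta>) p (s(i := x))"
  shows "\<exists>x\<in>hull X. sat (H \<theta>) p (s(i := x))"
proof -
  obtain N where N: "\<forall>j\<in>fv p. j < N"
    using finite_fv[of p] by (auto simp: finite_nat_set_iff_bounded)
  define xs where "xs = map s [0..<N]"
  have sat: "sat (H \<theta>) p (s(i := x)) \<longleftrightarrow> sat (H \<theta>) p ((assignment xs)(i := x))" for x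
    using N by (intro sat_cong) (auto simp: assignment_def xs_def)
  have "\<exists>x\<in>H \<theta>. sat (H \<theta>) p ((assignment xs)(i := x))"
    using ex sat by blast
  moreover have "\<forall>x\<in>set xs. x \<in> hull X"
    using s by (auto simp: xs_def)
  ultimately show ?thesis
    using sat skolem hull.step by blast
qed

text \<open>The Tarski-Vaught criterion: \<open>hull_witness\<close> settles the existential case of
  an induction on formulas.\<close>

lemma hull_elementary:
  assumes X: "X \<subseteq> H \<theta>" "X \<noteq> {}"
  shows "elementary_submodel \<theta> (hull X)"
proof -
  have "sat (hull X) p s \<longleftrightarrow> sat (H \<theta>) p s" if "range s \<subseteq> hull X" for p s
    using that
  proof (induction p arbitrary: s)
    case (Exists i p)
    have "sat (hull X) p (s(i := x)) \<longleftrightarrow> sat (H \<theta>) p (s(i := x))" if "x \<in> hull X" for x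
      using Exists.prems that by (intro Exists.IH) auto
    moreover have "(\<exists>x\<in>hull X. sat (H \<theta>) p (s(i := x))) \<longleftrightarrow> (\<exists>x\<in>H \<theta>. sat (H \<theta>) p (s(i := x)))"
      using hull_witness[OF Exists.prems, of p i] hull_subset_H[OF X(1)] by blast
    ultimately show ?case by simp
  qed auto
  then show ?thesis
    unfolding elementary_submodel_def
    using hull_subset_H[OF X(1)] subset_hull[of X] X(2) by blast
qed

text \<open>Each Skolem function has finitely many arguments, so their finite supports can be
  united. This makes the filtration by hulls continuous at limits.\<close>

lemma hull_finitary: "x \<in> hull X \<Longrightarrow> \<exists>F\<subseteq>X. finite F \<and> x \<in> hull F"
proof (induction rule: hull.induct)
  case (base x)
  then show ?case
    by (intro exI[of _ "{x}"]) (auto intro: hull.base)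
next
  case (step xs p i)
  then obtain F where F: "\<And>x. x \<in> set xs \<Longrightarrow> F x \<subseteq> X \<and> finite (F x) \<and> x \<in> hull (F x)"
    by metis
  have "x \<in> hull (\<Union>(F ` set xs))" if "x \<in> set xs" for x
    using F[OF that] hull_mono[of "F x" "\<Union>(F ` set xs)"] that by blast
  then have "skolem p i xs \<in> hull (\<Union>(F ` set xs))"
    using step by (intro hull.step) auto
  then show ?case
    using F by (intro exI[of _ "\<Union>(F ` set xs)"]) auto
qed

lemma card_of_hull:
  assumes X: "|X| \<le>o |Z|" and Z: "\<not> finite Z"
  shows "|hull X| \<le>o |Z|"
proof -
  \<comment> \<open>One round of closing under all Skolem functions; countably many rounds exhaust
    the hull, and none exceeds the size of \<open>Z\<close>.\<close>
  define close where "close = (\<lambda>T. T \<union> (\<lambda>((p, i), xs). skolem p i xs) ` (UNIV \<times> lists T))"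
  define L where "L m = (close ^^ m) X" for m
  have nat: "|UNIV :: nat set| \<le>o |Z|"
    using Z infinite_iff_card_of_nat by blast
  have fm: "|UNIV :: (fm \<times> nat) set| \<le>o |Z|"
    using nat countableI_type[of "UNIV :: (fm \<times> nat) set"] unfolding countable_def card_of_ordLeq[symmetric]
    by (meson card_of_ordLeq ordLeq_transitive subset_UNIV)
  have close: "|close T| \<le>o |Z|" if "|T| \<le>o |Z|" for T
  proof -
    have "|(UNIV :: (fm \<times> nat) set) \<times> lists T| \<le>o |Z|"
      using Z fm card_of_lists_ordLeq[OF that Z]
      by (intro card_of_Times_ordLeq_infinite_Field) (auto simp: Field_card_of card_of_card_order_on)
    then have "|(\<lambda>((p, i), xs). skolem p i xs) ` (UNIV \<times> lists T)| \<le>o |Z|"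
      by (meson card_of_image ordLeq_transitive)
    then show ?thesis
      unfolding close_def using Z that
      by (intro card_of_Un_ordLeq_infinite_Field) (auto simp: Field_card_of card_of_card_order_on)
  qed
  have "|L m| \<le>o |Z|" for m
    by (induction m) (use X close in \<open>auto simp: L_def\<close>)
  then have card: "|\<Union>m. L m| \<le>o |Z|"
    using Z nat by (intro card_of_UNION_ordLeq_infinite) auto
  have mono: "L m \<subseteq> L k" if "m \<le> k" for m k
    using that by (induction rule: dec_induct) (auto simp: L_def close_def)
  have "x \<in> (\<Union>m. L m)" if "x \<in> hull X" for x
    using that
  proof (induction rule: hull.induct)
    case (base x)
    then have "x \<in> L 0" by (simp add: L_def)
    then show ?case by blast
  next
    case (step xs p i)
    then obtain m where m: "\<And>x. x \<in> set xs \<Longrightarrow> x \<in> L (m x)"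
      by (metis UN_iff)
    \<comment> \<open>The stages increase, so the largest stage among the entries of
      \<open>xs\<close> contains them all. Inserting 0 covers the empty list.\<close>
    define k where "k = Max (insert 0 (m ` set xs))"
    have "m x \<le> k" if "x \<in> set xs" for x
      using that by (simp add: k_def)
    then have "xs \<in> lists (L k)"
      using m mono by blast
    then have "skolem p i xs \<in> close (L k)"
      unfolding close_def by (intro UnI2 image_eqI[of _ _ "((p, i), xs)"]) auto
    then have "skolem p i xs \<in> L (Suc k)"
      by (simp add: L_def)
    then show ?case by blast
  qed
  then have "hull X \<subseteq> (\<Union>m. L m)" by blast
  then show ?thesis
    using card by (meson card_of_mono1 ordLeq_transitive)
qed

text \<open>An infinite \<open>X\<close> has a hull of at most its own size. A finite
  \<open>X\<close> may have an infinite hull, but a countable one, and \<open>Z\<close> is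
  uncountable.\<close>

lemma card_of_hull_less:
  assumes "|X| <o |Z|" "uncountable Z"
  shows "|hull X| <o |Z|"
proof (cases "finite X")
  case True
  have "|X| \<le>o |UNIV :: nat set|"
    using countable_finite[OF True] unfolding countable_def card_of_ordLeq[symmetric] by blast
  then have "|hull X| \<le>o |UNIV :: nat set|"
    by (intro card_of_hull) auto
  moreover have "|UNIV :: nat set| <o |Z|"
    using assms(2) unfolding countable_def card_of_ordLeq[symmetric]
    by (metis card_of_ordLeq card_of_Well_order not_ordLeq_iff_ordLess subset_UNIV)
  ultimately show ?thesis by (rule ordLeq_ordLess_trans)
next
  case False
  then have "|hull X| \<le>o |X|"
    by (intro card_of_hull) (auto intro: card_of_mono1)
  then show ?thesis
    using assms(1) by (rule ordLeq_ordLess_trans)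
qed

end

section \<open>Colorings avoiding the classes of a chain\<close>

context grid_universe
begin

definition avoiding_coloring :: "'k hs set \<Rightarrow> 'k hs set \<Rightarrow> ('k hs \<Rightarrow> nat) \<Rightarrow> bool" where
  "avoiding_coloring Ms B \<chi> \<longleftrightarrow>
    (\<forall>x\<in>B. \<chi> x < n \<and> cls (\<chi> x) x \<notin> \<Union>(elts ` Ms)) \<and>
    (\<forall>a\<in>elts A. \<forall>i<n. finite {x \<in> B. (a, x) \<in> E i \<and> \<chi> x = i})"

text \<open>If the two classes share a point \<open>z\<close>, both are classes of \<open>z\<close>,
  and the grid condition applies at \<open>z\<close>.\<close>

lemma finite_Int_two_classes:
  assumes "i < n" "j < n" "i \<noteq> j"
  shows "finite (E i `` {a} \<inter> E j `` {b})"
proof (cases "E i `` {a} \<inter> E j `` {b} = {}")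
  case False
  then obtain z where z: "(a, z) \<in> E i" "(b, z) \<in> E j" by blast
  then have "E i `` {a} \<inter> E j `` {b} = E i `` {z} \<inter> E j `` {z}"
    using equiv_E assms by (metis equiv_class_eq)
  moreover have "z \<in> elts A"
    using z E_subset[OF assms(1)] by blast
  ultimately show ?thesis
    using finite_Int_classes assms by simp
qed simp

text \<open>
  Every point takes a color whose class is met as late as possible by an enumeration of \<open>B\<close>,
  among the classes outside the chain.  A point of color \<open>i\<close> is then either almost covered or
  lies in one of finitely many other classes determined by its \<open>i\<close>-th class.
\<close>

lemma countable_avoiding_coloring:
  assumes tw: "twisted \<theta> n A E" and n: "n > 0" and Ms: "chain Ms"
    and B: "B \<subseteq> elts A - \<Union>(elts ` Ms)" "countable B"
  shows "\<exists>\<chi>. avoiding_coloring Ms B \<chi>"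
proof -
  let ?U = "\<Union>(elts ` Ms)"
  obtain \<nu> :: "'k hs \<Rightarrow> nat" where \<nu>: "inj_on \<nu> B"
    using B(2) by (auto simp: countable_def)
  define idx where "idx i x = (LEAST k. \<exists>y\<in>B. (x, y) \<in> E i \<and> \<nu> y = k)" for i x
  define avail where "avail x = {i. i < n \<and> cls i x \<notin> ?U}" for x
  have idx: "\<exists>y\<in>B. (x, y) \<in> E i \<and> \<nu> y = idx i x" if "x \<in> B" "i < n" for i x
    unfolding idx_def by (rule LeastI_ex) (use that refl_E B(1) in blast)
  have "\<exists>i\<in>avail x. \<forall>j\<in>avail x. idx j x \<le> idx i x" if "x \<in> B" for x
  proof -
    have "finite (avail x)" "avail x \<noteq> {}"
      using not_all_covered[OF tw Ms _ n, of x] that B(1) by (auto simp: avail_def)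
    then have "Max ((\<lambda>i. idx i x) ` avail x) \<in> (\<lambda>i. idx i x) ` avail x"
      by (intro Max_in) auto
    then obtain i where "i \<in> avail x" "idx i x = Max ((\<lambda>i. idx i x) ` avail x)"
      by (metis imageE)
    then show ?thesis
      using \<open>finite (avail x)\<close> by (metis Max_ge finite_imageI imageI)
  qed
  then obtain \<chi> where \<chi>: "\<And>x. x \<in> B \<Longrightarrow> \<chi> x \<in> avail x \<and> (\<forall>j\<in>avail x. idx j x \<le> idx (\<chi> x) x)"
    by metis
  have "finite {x \<in> B. (a, x) \<in> E i \<and> \<chi> x = i}" (is "finite ?Z") if a: "a \<in> elts A" "i < n" for a i
  proof (cases "?Z = {}")
    case False
    then obtain x0 where x0: "x0 \<in> ?Z" by blast
    \<comment> \<open>All points of \<open>?Z\<close> share their \<open>i\<close>-th class, hence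
      the index \<open>N\<close>. Maximality of their color bounds the indices of their other
      available classes by \<open>N\<close>.\<close>
    define N where "N = idx i x0"
    let ?Y = "{y \<in> B. \<nu> y \<le> N}"
    have "?Z \<subseteq> (E i `` {a} \<inter> almost_covered i Ms) \<union>
        (\<Union>j\<in>{..<n} - {i}. \<Union>y\<in>?Y. E i `` {a} \<inter> E j `` {y})"
    proof
      fix x
      assume x: "x \<in> ?Z"
      show "x \<in> (E i `` {a} \<inter> almost_covered i Ms) \<union>
          (\<Union>j\<in>{..<n} - {i}. \<Union>y\<in>?Y. E i `` {a} \<inter> E j `` {y})"
      proof (cases "avail x \<subseteq> {i}")
        case True
        then have "\<forall>j\<in>{..<n} - {i}. cls j x \<in> ?U"
          by (auto simp: avail_def)
        moreover have "x \<in> elts A - ?U"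
          using x B(1) by blast
        ultimately have "x \<in> almost_covered i Ms"
          unfolding almost_covered_def by simp
        then show ?thesis using x by blast
      next
        case False
        then obtain j where j: "j \<in> avail x" "j \<noteq> i" by blast
        have "(x, y) \<in> E i \<longleftrightarrow> (x0, y) \<in> E i" for y
          using x x0 equiv_class_eq[OF equiv_E[OF a(2)], of a] by blast
        then have "idx i x = N"
          unfolding N_def idx_def by simp
        then have "idx j x \<le> N"
          using \<chi>[of x] x j by auto
        moreover obtain y where "y \<in> B" "(x, y) \<in> E j" "\<nu> y = idx j x"
          using idx[of x j] x j by (auto simp: avail_def)
        ultimately show ?thesis
          using x j sym_E[of j x y] by (auto simp: avail_def)
      qed
    qed
    moreover have "finite ?Y"
      by (rule finite_imageD[of \<nu>])
        (auto intro!: finite_subset[of _ "{..N}"] inj_on_subset[OF \<nu>])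
    then have "finite (\<Union>j\<in>{..<n} - {i}. \<Union>y\<in>?Y. E i `` {a} \<inter> E j `` {y})"
      using a(2) by (intro finite_UN_I finite_Int_two_classes) auto
    moreover have "finite (E i `` {a} \<inter> almost_covered i Ms)"
      using almost_covered_small[OF tw Ms a(2,1)] .
    ultimately show ?thesis
      by (meson finite_UnI finite_subset)
  qed (metis finite.emptyI)
  then have "avoiding_coloring Ms B \<chi>"
    unfolding avoiding_coloring_def using \<chi> by (auto simp: avail_def)
  then show ?thesis by blast
qed

text \<open>
  Induction on the cardinality of \<open>B\<close>: an uncountable \<open>B\<close> is exhausted by the Skolem hulls of the
  initial segments of a well-order of type \<open>|B|\<close>, and each hull extends the chain by one model.
\<close>

lemma avoiding_coloring_exists:
  assumes tw: "twisted \<theta> n A E" and n: "n > 0"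
  shows "chain Ms \<Longrightarrow> B \<subseteq> elts A - \<Union>(elts ` Ms) \<Longrightarrow> \<exists>\<chi>. avoiding_coloring Ms B \<chi>"
\<comment> \<open>\<open>Ms\<close> is generalized because smaller sets are colored relative to a
  chain extended by one model.\<close>
proof (induction B arbitrary: Ms rule: wf_induct_rule[OF wf_inv_image[OF wf_ordLess, of card_of]])
  case (1 B)
  have IH: "\<exists>\<chi>. avoiding_coloring Ns C \<chi>"
    if "|C| <o |B|" "chain Ns" "C \<subseteq> elts A - \<Union>(elts ` Ns)" for Ns C
    using 1(1) that by (simp add: inv_image_def)
  note Ms = 1(2) and B = 1(3)
  show ?case
  proof (cases "countable B")
    case True
    then show ?thesis
      using countable_avoiding_coloring[OF tw n Ms B] by blast
  next
    case False
    then have inf: "infinite B"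
      using countable_finite by blast
    let ?r = "|B|"
    have wo: "Well_order ?r" and Fr: "Field ?r = B"
      by (auto simp: card_of_well_order_on Field_card_of)
    have r: "Refl ?r" "trans ?r" "antisym ?r" "Total ?r" "wf (?r - Id)"
      using wo by (auto simp: well_order_on_def linear_order_on_def partial_order_on_def preorder_on_def)
    \<comment> \<open>Keeping \<open>Ms\<close> inside every hull lets each coded hull be appended
      to the chain; the grid code makes the hull a model.\<close>
    define P where "P = insert (grid_code n A E) Ms"
    \<comment> \<open>\<open>K b\<close> is the stage before \<open>b\<close> is added and
      \<open>L b\<close> the stage after. Both are smaller than \<open>B\<close>, so the induction
      hypothesis applies to the points entering between them.\<close>
    define K where "K b = hull (P \<union> underS ?r b)" for b
    define L where "L b = hull (P \<union> under ?r b)" for b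
    have BH: "B \<subseteq> H \<theta>"
      using B H_transitive[OF A_in_H] by blast
    have PH: "P \<subseteq> H \<theta>"
      using Ms grid_code_in_H by (auto simp: P_def chain_def)
    have seg: "underS ?r b \<subseteq> B" for b
      using FieldI1[of _ b ?r] by (auto simp: underS_def Fr)
    have KH: "K b \<subseteq> H \<theta>" for b
      unfolding K_def using PH BH seg[of b] by (intro hull_subset_H) blast
    have less: "|P \<union> X| <o |B|" if "|X| <o |B|" for X
    proof -
      have "finite P"
        using Ms by (simp add: P_def chain_def)
      then show ?thesis
        using that inf card_of_finite_ordLess_infinite[of P B] by (intro card_of_Un_ordLess_infinite) auto
    qed
    have cardK: "|K b| <o |B|" and cardL: "|L b| <o |B|" if "b \<in> B" for b
    proof -
      have S: "|underS ?r b| <o |B|"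
        using that by (intro card_of_underS) (auto simp: card_of_card_order_on Field_card_of)
      moreover have "under ?r b = underS ?r b \<union> {b}"
        using that r(1) by (intro Refl_under_underS) (auto simp: Fr)
      moreover have "|{b}| <o |B|"
        using inf card_of_finite_ordLess_infinite[of "{b}" B] by blast
      ultimately have U: "|under ?r b| <o |B|"
        using inf card_of_Un_ordLess_infinite by metis
      show "|K b| <o |B|" "|L b| <o |B|"
        unfolding K_def L_def using less[OF S] less[OF U] False by (auto intro: card_of_hull_less)
    qed
    have cardB: "|B| <o \<theta>"
      using elts_less[OF A_in_H] B by (meson Diff_subset order_trans subset_less)
    have K_less: "|K b| <o \<theta>" if "b \<in> B" for b
      using cardK[OF that] cardB ordLess_transitive by blast
    have elts_K: "elts (set_of (K b)) = K b" if "b \<in> B" for b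
      using K_less[OF that] by (rule elts_set_of_less)
    have PK: "P \<subseteq> K b" for b
      unfolding K_def using subset_hull by blast
    have model_K: "model (K b)" for b
      unfolding model_def
    proof
      show "elementary_submodel \<theta> (K b)"
        unfolding K_def using PH BH seg[of b] by (intro hull_elementary) (auto simp: P_def)
      show "grid_code n A E \<in> K b"
        using PK[of b] by (simp add: P_def)
    qed
    have chain_K: "chain (insert (set_of (K b)) Ms)" if "b \<in> B" for b
    proof -
      have "set_of (K b) \<in> H \<theta>"
        using KH K_less[OF that] by (rule set_of_in_H)
      moreover have "Ms \<subseteq> elts (set_of (K b))"
        using PK[of b] by (simp add: elts_K[OF that] P_def)
      moreover have "model (elts (set_of (K b)))"
        using model_K by (simp add: elts_K[OF that])
      ultimately show ?thesis
        using Ms unfolding chain_def by blast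
    qed
    define layer where "layer b = B \<inter> L b - K b" for b
    have "\<exists>\<chi>. avoiding_coloring (insert (set_of (K b)) Ms) (layer b) \<chi>" if "b \<in> B" for b
    proof (rule IH[OF _ chain_K[OF that]])
      show "|layer b| <o |B|"
        using cardL[OF that] card_of_mono1[of "layer b" "L b"]
        by (auto simp: layer_def intro: ordLeq_ordLess_trans)
      show "layer b \<subseteq> elts A - \<Union>(elts ` insert (set_of (K b)) Ms)"
        using B by (auto simp: layer_def elts_K[OF that])
    qed
    then obtain \<chi>1 where \<chi>1: "\<And>b. b \<in> B \<Longrightarrow>
        avoiding_coloring (insert (set_of (K b)) Ms) (layer b) (\<chi>1 b)"
      by metis
    have "|hull P| <o |B|"
      using less[of "{}"] inf card_of_finite_ordLess_infinite[of "{} :: 'k hs set" B] False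
      by (auto intro: card_of_hull_less)
    then have "|B \<inter> hull P| <o |B|"
      by (meson Int_lower2 card_of_mono1 ordLeq_ordLess_trans)
    \<comment> \<open>Points of \<open>hull P\<close> precede every stage and are colored relative
      to \<open>Ms\<close> alone.\<close>
    then obtain \<chi>0 where \<chi>0: "avoiding_coloring Ms (B \<inter> hull P) \<chi>0"
      using IH[of "B \<inter> hull P" Ms] Ms B by blast
    \<comment> \<open>Take the least \<open>b\<close> with \<open>x\<close> in \<open>L b\<close>.
      Were \<open>x\<close> already in \<open>K b\<close>, finitely many generators would suffice;
      with none outside \<open>P\<close>, \<open>x\<close> would lie in \<open>hull P\<close>, and
      otherwise the greatest one outside \<open>P\<close> would be an earlier index.\<close>
    have cover: "\<exists>b\<in>B. x \<in> layer b" if x: "x \<in> B" "x \<notin> hull P" for x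
    proof -
      let ?S = "{b \<in> B. x \<in> L b}"
      have "x \<in> under ?r x"
        using r(1) x(1) by (intro Refl_under_in) (auto simp: Fr)
      then have xS: "x \<in> ?S"
        using x(1) subset_hull unfolding L_def by blast
      obtain b where b: "b \<in> ?S" "\<And>c. (c, b) \<in> ?r - Id \<Longrightarrow> c \<notin> ?S"
        by (rule wfE_min[OF r(5) xS]) (rule that)
      have "x \<notin> K b"
      proof
        assume "x \<in> K b"
        then obtain F where F: "F \<subseteq> P \<union> underS ?r b" "finite F" "x \<in> hull F"
          using hull_finitary unfolding K_def by blast
        show False
        proof (cases "F \<subseteq> P")
          case True
          then show False using F(3) x(2) hull_mono by blast
        next
          case False
          define G where "G = F - P"
          have G: "finite G" "G \<noteq> {}" "G \<subseteq> underS ?r b"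
            using False F by (auto simp: G_def)
          have "transp_on G (\<lambda>c d. (c, d) \<in> ?r)"
            using r(2) by (intro transp_onI) (meson transD)
          moreover have "totalp_on G (\<lambda>c d. (c, d) \<in> ?r)"
            using r(4) G(3) seg[of b] by (intro totalp_onI) (auto simp: total_on_def Fr subset_iff)
          ultimately obtain c where c: "c \<in> G" "\<And>d. d \<in> G \<Longrightarrow> d \<noteq> c \<Longrightarrow> (d, c) \<in> ?r"
            using Finite_Set.bex_greatest_element[OF G(1,2)] by blast
          have cb: "(c, b) \<in> ?r - Id" "c \<in> B"
            using c(1) G(3) seg[of b] by (auto simp: underS_def)
          have "c \<in> under ?r c"
            using r(1) cb(2) by (intro Refl_under_in) (auto simp: Fr)
          then have "F \<subseteq> P \<union> under ?r c"
            using c unfolding G_def under_def by blast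
          then have "x \<in> L c"
            using F(3) hull_mono unfolding L_def by blast
          then show False using b(2)[OF cb(1)] cb(2) by blast
        qed
      qed
      then show ?thesis
        using b(1) x(1) unfolding layer_def by blast
    qed
    then obtain \<beta> where \<beta>: "\<And>x. x \<in> B \<Longrightarrow> x \<notin> hull P \<Longrightarrow> \<beta> x \<in> B \<and> x \<in> layer (\<beta> x)"
      by metis
    define \<chi> where "\<chi> x = (if x \<in> hull P then \<chi>0 x else \<chi>1 (\<beta> x) x)" for x
    have \<chi>_avoids: "\<chi> x < n \<and> cls (\<chi> x) x \<notin> K (\<beta> x) \<and> cls (\<chi> x) x \<notin> \<Union>(elts ` Ms)"
      if "x \<in> B" "x \<notin> hull P" for x
      using \<chi>1[of "\<beta> x"] \<beta>[OF that] that elts_K[of "\<beta> x"]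
      unfolding avoiding_coloring_def \<chi>_def by simp
    \<comment> \<open>If \<open>x\<close> entered strictly before \<open>y\<close>, the model
      \<open>K (\<beta> y)\<close> would contain \<open>x\<close> and hence the class that
      \<open>x\<close> and \<open>y\<close> share, which the color of \<open>y\<close>
      avoids.\<close>
    have not_before: "(\<beta> x, \<beta> y) \<notin> ?r - Id"
      if x: "x \<in> B" "x \<notin> hull P" and y: "y \<in> B" "y \<notin> hull P"
        and xy: "(x, y) \<in> E (\<chi> y)" for x y
    proof
      assume "(\<beta> x, \<beta> y) \<in> ?r - Id"
      then have "under ?r (\<beta> x) \<subseteq> underS ?r (\<beta> y)"
        using r(2,3) unfolding under_def underS_def by (auto dest: transD antisymD)
      then have "L (\<beta> x) \<subseteq> K (\<beta> y)"
        unfolding L_def K_def by (intro hull_mono) blast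
      then have "x \<in> K (\<beta> y)"
        using \<beta>[OF x] unfolding layer_def by blast
      then have "cls (\<chi> y) x \<in> K (\<beta> y)"
        using \<chi>_avoids[OF y] by (intro cls_in_model model_K) auto
      then show False
        using \<chi>_avoids[OF y] cls_eq[OF _ xy] by simp
    qed
    have "finite {x \<in> B. (a, x) \<in> E i \<and> \<chi> x = i}" if a: "a \<in> elts A" "i < n" for a i
    proof -
      let ?Z = "{x \<in> B - hull P. (a, x) \<in> E i \<and> \<chi> x = i}"
      have "finite ?Z"
      proof (cases "?Z = {}")
        case False
        then obtain y where y: "y \<in> ?Z" by blast
        \<comment> \<open>Two points of \<open>?Z\<close> share the class of their common color, so
          \<open>not_before\<close> applies in both directions and totality forces equal stages.
          Finiteness thus reduces to a single layer.\<close>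
        have same: "\<beta> x = \<beta> y" if x: "x \<in> ?Z" for x
        proof (rule ccontr)
          assume neq: "\<beta> x \<noteq> \<beta> y"
          have "(x, y) \<in> E i" "(y, x) \<in> E i"
            using x y equiv_E[OF a(2)] by (auto elim!: equivE dest: symD transD)
          then have "(\<beta> x, \<beta> y) \<notin> ?r" "(\<beta> y, \<beta> x) \<notin> ?r"
            using not_before[of x y] not_before[of y x] x y neq by auto
          moreover have "\<beta> x \<in> B" "\<beta> y \<in> B"
            using \<beta> x y by auto
          ultimately show False
            using r(4) neq by (auto simp: total_on_def Fr)
        qed
        have "?Z \<subseteq> {x \<in> layer (\<beta> y). (a, x) \<in> E i \<and> \<chi>1 (\<beta> y) x = i}"
        proof
          fix x
          assume x: "x \<in> ?Z"
          then show "x \<in> {x \<in> layer (\<beta> y). (a, x) \<in> E i \<and> \<chi>1 (\<beta> y) x = i}"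
            using \<beta>[of x] same[OF x] by (auto simp: \<chi>_def)
        qed
        moreover have "finite {x \<in> layer (\<beta> y). (a, x) \<in> E i \<and> \<chi>1 (\<beta> y) x = i}"
          using \<chi>1[of "\<beta> y"] \<beta>[of y] y a unfolding avoiding_coloring_def by blast
        ultimately show ?thesis by (rule finite_subset)
      qed (metis finite.emptyI)
      moreover have "finite {x \<in> B \<inter> hull P. (a, x) \<in> E i \<and> \<chi>0 x = i}"
        using \<chi>0 a unfolding avoiding_coloring_def by blast
      moreover have "{x \<in> B. (a, x) \<in> E i \<and> \<chi> x = i} \<subseteq>
          ?Z \<union> {x \<in> B \<inter> hull P. (a, x) \<in> E i \<and> \<chi>0 x = i}"
        by (auto simp: \<chi>_def)
      ultimately show ?thesis
        by (meson finite_UnI finite_subset)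
    qed
    moreover have "\<chi> x < n \<and> cls (\<chi> x) x \<notin> \<Union>(elts ` Ms)" if "x \<in> B" for x
    proof (cases "x \<in> hull P")
      case True
      then show ?thesis
        using \<chi>0 that unfolding avoiding_coloring_def \<chi>_def by simp
    qed (use \<chi>_avoids that in blast)
    ultimately have "avoiding_coloring Ms B \<chi>"
      unfolding avoiding_coloring_def by blast
    then show ?thesis by blast
  qed
qed

text \<open>The whole of \<open>A\<close> is colored over the empty chain, which forbids no
  color.\<close>

lemma twisted_imp_coloring:
  assumes "twisted \<theta> n A E" "n > 0"
  shows "\<exists>\<chi>. acceptable_coloring n A E \<chi>"
proof -
  obtain \<chi> where \<chi>: "avoiding_coloring {} (elts A) \<chi>"
    using avoiding_coloring_exists[OF assms, of "{}" "elts A"] by (auto simp: chain_def)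
  have "E i `` {a} \<inter> {x \<in> elts A. \<chi> x = i} = {x \<in> elts A. (a, x) \<in> E i \<and> \<chi> x = i}" for a i
    by auto
  then have "acceptable_coloring n A E \<chi>"
    using \<chi> unfolding acceptable_coloring_def avoiding_coloring_def by auto
  then show ?thesis by blast
qed

section \<open>Colorings in elementary submodels\<close>

text \<open>
  A coloring is coded by the set of all pairs of a point and the numeral of its color.
  Finiteness of \<open>X\<close> is expressed by: every nonempty family of subsets of \<open>X\<close> has a maximal element.
  The families of subsets of \<open>A\<close> belong to \<open>H \<theta>\<close> because \<open>\<theta>\<close> exceeds the size of the power set.
\<close>

definition internally_finite :: "'k hs \<Rightarrow> bool" where
  "internally_finite X \<longleftrightarrow> \<not> (\<exists>F\<in>H \<theta>. (\<exists>Y\<in>elts F. True) \<and> (\<forall>Y\<in>elts F. (\<forall>z\<in>elts Y. z \<in> elts X) \<and>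
     (\<exists>Z\<in>elts F. (\<forall>z\<in>elts Y. z \<in> elts Z) \<and> (\<exists>z\<in>elts Z. z \<notin> elts Y))))"

lemma dfn_internally_finite:
  assumes "M \<subseteq> H \<theta>" "M \<noteq> {}" "dtm M t"
  shows "dfn M (\<lambda>s. internally_finite (t s))"
  unfolding internally_finite_def using assms by (intro dfn_intros dfn_True)

text \<open>A code may give a point several colors. The bounding set \<open>X\<close> is required to
  lie in \<open>A\<close>, where internal finiteness agrees with finiteness.\<close>

definition coloring_code :: "'k hs \<Rightarrow> bool" where
  "coloring_code c \<longleftrightarrow> (\<forall>x\<in>elts A. \<exists>i\<in>{..<n}. pair x (num i) \<in> elts c) \<and>
    (\<forall>i\<in>{..<n}. \<forall>a\<in>elts A. \<exists>X\<in>H \<theta>. internally_finite X \<and> (\<forall>x\<in>elts X. x \<in> elts A) \<and>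
      (\<forall>x\<in>elts A. (a, x) \<in> E i \<and> pair x (num i) \<in> elts c \<longrightarrow> x \<in> elts X))"

lemma dfn_coloring_code:
  assumes M: "model M" "dtm M t"
  shows "dfn M (\<lambda>s. coloring_code (t s))"
  unfolding coloring_code_def
  using M(2) model_subset[OF M(1)] model_nonempty[OF M(1)] model_A[OF M(1)]
    elementary_num[OF model_elementary[OF M(1)]]
  by (intro dfn_internally_finite dfn_pair_mem dfn_E[OF M(1)] dfn_intros) auto

end

locale large_grid_universe = grid_universe +
  assumes Pow_A: "|Pow (elts A)| <o \<theta>"
begin

text \<open>The finite subsets of an infinite set form a family without maximal element.\<close>

lemma internally_finite_iff:
  assumes "elts X \<subseteq> elts A"
  shows "internally_finite X \<longleftrightarrow> finite (elts X)"
proof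
  assume fin: "finite (elts X)"
  show "internally_finite X"
    unfolding internally_finite_def
  proof (rule notI, elim bexE conjE)
    fix F Y
    assume F: "\<forall>Y\<in>elts F. (\<forall>z\<in>elts Y. z \<in> elts X) \<and>
        (\<exists>Z\<in>elts F. (\<forall>z\<in>elts Y. z \<in> elts Z) \<and> (\<exists>z\<in>elts Z. z \<notin> elts Y))"
      and Y: "Y \<in> elts F"
    have "finite (elts ` elts F)"
      using F fin by (intro finite_subset[of "elts ` elts F" "Pow (elts X)"]) auto
    then have "\<exists>S\<in>elts ` elts F. \<forall>T\<in>elts ` elts F. S \<subseteq> T \<longrightarrow> S = T"
      using Y by (intro finite_has_maximal) auto
    then obtain Y' where Y': "Y' \<in> elts F" "\<forall>Z\<in>elts F. elts Y' \<subseteq> elts Z \<longrightarrow> elts Y' = elts Z"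
      unfolding bex_simps ball_simps by (elim bexE)
    obtain Z where "Z \<in> elts F" "\<forall>z\<in>elts Y'. z \<in> elts Z" "\<exists>z\<in>elts Z. z \<notin> elts Y'"
      using F Y'(1) by metis
    then show False
      using Y'(2) by (metis subsetI)
  qed
next
  assume X: "internally_finite X"
  show "finite (elts X)"
  proof (rule ccontr)
    assume inf: "infinite (elts X)"
    let ?F = "set_of ` {S. finite S \<and> S \<subseteq> elts X}"
    have less: "|?F| <o \<theta>"
      using Pow_A assms by (intro image_less subset_less[OF Pow_A]) auto
    have sub: "elts X \<subseteq> H \<theta>"
      using assms H_transitive[OF A_in_H] by blast
    have "set_of ?F \<in> H \<theta>"
      using sub by (intro set_of_in_H less) (auto intro: finite_set_of_in_H)
    moreover have "\<exists>Z\<in>?F. (\<forall>z\<in>elts Y. z \<in> elts Z) \<and> (\<exists>z\<in>elts Z. z \<notin> elts Y)"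
      and "\<forall>z\<in>elts Y. z \<in> elts X" if "Y \<in> ?F" for Y
    proof -
      obtain S where S: "finite S" "S \<subseteq> elts X" "Y = set_of S"
        using \<open>Y \<in> ?F\<close> by blast
      then have Y: "elts Y = S"
        by (simp add: elts_set_of_finite)
      obtain z where z: "z \<in> elts X" "z \<notin> S"
        using inf S by (meson finite_subset subsetI)
      have "elts (set_of (insert z S)) = insert z S"
        using S(1) by (simp add: elts_set_of_finite)
      moreover have "set_of (insert z S) \<in> ?F"
        using S z by blast
      ultimately show "\<exists>Z\<in>?F. (\<forall>z\<in>elts Y. z \<in> elts Z) \<and> (\<exists>z\<in>elts Z. z \<notin> elts Y)"
        using z Y by blast
      show "\<forall>z\<in>elts Y. z \<in> elts X"
        using S(2) Y by blast
    qed
    moreover have "set_of {} \<in> ?F" by blast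
    ultimately have "\<exists>F\<in>H \<theta>. (\<exists>Y\<in>elts F. True) \<and> (\<forall>Y\<in>elts F. (\<forall>z\<in>elts Y. z \<in> elts X) \<and>
       (\<exists>Z\<in>elts F. (\<forall>z\<in>elts Y. z \<in> elts Z) \<and> (\<exists>z\<in>elts Z. z \<notin> elts Y)))"
      by (intro bexI[of _ "set_of ?F"]) (unfold elts_set_of_less[OF less], blast+)
    then show False
      using X unfolding internally_finite_def by blast
  qed
qed

section \<open>Existence of codes and their effect inside models\<close>

lemma coloring_code_exists:
  assumes \<chi>: "acceptable_coloring n A E \<chi>"
  shows "\<exists>c\<in>H \<theta>. coloring_code c"
proof -
  let ?c = "(\<lambda>x. pair x (num (\<chi> x))) ` elts A"
  have less: "|?c| <o \<theta>"
    by (intro image_less elts_less A_in_H)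
  have "set_of ?c \<in> H \<theta>"
    using H_transitive[OF A_in_H] by (intro set_of_in_H less) (auto intro!: pair_in_H num_in_H)
  moreover have "coloring_code (set_of ?c)"
    unfolding coloring_code_def elts_set_of_less[OF less]
  proof (intro conjI ballI)
    fix x
    assume "x \<in> elts A"
    then show "\<exists>i\<in>{..<n}. pair x (num i) \<in> ?c"
      using \<chi> by (auto simp: acceptable_coloring_def)
  next
    fix i a
    assume i: "i \<in> {..<n}" and a: "a \<in> elts A"
    let ?X = "E i `` {a} \<inter> {x \<in> elts A. \<chi> x = i}"
    have fin: "finite ?X"
      using \<chi> i a by (simp add: acceptable_coloring_def)
    have sub: "?X \<subseteq> elts A" by blast
    have "internally_finite (set_of ?X)"
      using fin by (subst internally_finite_iff) (auto simp: elts_set_of_finite)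
    moreover have "set_of ?X \<in> H \<theta>"
      using subset_in_H[OF A_in_H sub] .
    moreover have "\<forall>x\<in>elts A. (a, x) \<in> E i \<and> pair x (num i) \<in> ?c \<longrightarrow> x \<in> elts (set_of ?X)"
      using fin by (auto simp: elts_set_of_finite pair_eq_iff num_eq_iff)
    moreover have "\<forall>x\<in>elts (set_of ?X). x \<in> elts A"
      using fin by (auto simp: elts_set_of_finite)
    ultimately show "\<exists>X\<in>H \<theta>. internally_finite X \<and> (\<forall>x\<in>elts X. x \<in> elts A) \<and>
        (\<forall>x\<in>elts A. (a, x) \<in> E i \<and> pair x (num i) \<in> ?c \<longrightarrow> x \<in> elts X)"
      by blast
  qed
  ultimately show ?thesis by blast
qed

text \<open>The points of color \<open>i\<close> in the class of \<open>x\<close> form a finite set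
  definable over \<open>M\<close> from the class and the code, so \<open>M\<close> contains them
  all.\<close>

lemma coloring_code_in_model:
  assumes M: "model M" and c: "coloring_code c" "c \<in> M" and x: "x \<in> elts A" and i: "i < n"
    and col: "pair x (num i) \<in> elts c" and cls: "cls i x \<in> M"
  shows "x \<in> M"
proof -
  let ?W = "{y \<in> elts (cls i x). pair y (num i) \<in> elts c}"
  obtain X where X: "internally_finite X" "elts X \<subseteq> elts A"
    "\<And>y. y \<in> elts A \<Longrightarrow> (x, y) \<in> E i \<Longrightarrow> pair y (num i) \<in> elts c \<Longrightarrow> y \<in> elts X"
    using c(1) x i unfolding coloring_code_def by blast
  have "finite (elts X)"
    using X internally_finite_iff by blast
  moreover have "?W \<subseteq> elts X"
    using X(3) E_subset[OF i] by (auto simp: elts_cls[OF i])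
  ultimately have "finite ?W"
    by (rule rev_finite_subset)
  moreover have "dfn M (\<lambda>s. pair (s 0) (num i) \<in> elts c)"
    using model_subset[OF M] c(2) elementary_num[OF model_elementary[OF M]]
    by (intro dfn_pair_mem dfn_intros)
  ultimately have "?W \<subseteq> M"
    by (intro elementary_finite_separation[OF model_elementary[OF M] cls])
  then show ?thesis
    using refl_E[OF i x] col by (auto simp: elts_cls[OF i])
qed

text \<open>
  The models need not be increasing, so a code is found in all of them at once by applying
  elementarity in the last model, which has the other models as elements.
\<close>

lemma coloring_code_in_all_models:
  assumes ex: "\<exists>c\<in>H \<theta>. coloring_code c"
  shows "finite \<M> \<Longrightarrow> \<M> \<noteq> {} \<Longrightarrow> \<forall>M\<in>\<M>. model M \<Longrightarrow>
    strict_linear_order_on \<M> {(M, N). M \<in> \<M> \<and> N \<in> \<M> \<and> set_mem M N} \<Longrightarrow>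
    \<exists>c\<in>\<Inter>\<M>. coloring_code c"
proof (induction "card \<M>" arbitrary: \<M>)
  case (Suc m)
  note models = Suc.prems(3) and lin = Suc.prems(4)
  have mem_trans: "set_mem L N" if "L \<in> \<M>" "M \<in> \<M>" "N \<in> \<M>" "set_mem L M" "set_mem M N" for L M N
    using lin that unfolding strict_linear_order_on_def trans_def by blast
  have mem_total: "set_mem M N \<or> set_mem N M" if "M \<in> \<M>" "N \<in> \<M>" "M \<noteq> N" for M N
    using lin that unfolding strict_linear_order_on_def total_on_def by blast
  have mem_irrefl: "\<not> set_mem M M" if "M \<in> \<M>" for M
    using lin that unfolding strict_linear_order_on_def irrefl_def by blast
  have "transp_on \<M> set_mem"
    by (intro transp_onI) (blast intro: mem_trans)
  moreover have "totalp_on \<M> set_mem"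
    by (intro totalp_onI) (blast dest: mem_total)
  ultimately obtain T where T: "T \<in> \<M>" "\<And>M. M \<in> \<M> \<Longrightarrow> M \<noteq> T \<Longrightarrow> set_mem M T"
    using Finite_Set.bex_greatest_element[OF Suc.prems(1,2)] by metis
  let ?N = "\<M> - {T}"
  \<comment> \<open>\<open>f\<close> represents the other models by elements of \<open>T\<close>, so
    that lying in all of them becomes a predicate with parameters in \<open>T\<close>.\<close>
  obtain f where f: "\<And>M. M \<in> ?N \<Longrightarrow> f M \<in> T \<and> elts (f M) = M"
    using T(2) unfolding set_mem_def by (metis DiffE singletonI)
  have "\<exists>c\<in>H \<theta>. coloring_code c \<and> (\<forall>M\<in>?N. c \<in> M)"
  proof (cases "?N = {}")
    case False
    have "strict_linear_order_on ?N {(M, N). M \<in> ?N \<and> N \<in> ?N \<and> set_mem M N}"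
      unfolding strict_linear_order_on_def
      using mem_irrefl by (auto simp: irrefl_def total_on_def intro!: transI dest: mem_total intro: mem_trans)
    moreover have "card ?N = m"
      using Suc.hyps(2) Suc.prems(1) T(1) by simp
    ultimately obtain c where c: "c \<in> \<Inter>?N" "coloring_code c"
      using Suc.hyps(1)[of ?N] Suc.prems(1) False models by blast
    moreover obtain M where "M \<in> ?N"
      using False by blast
    ultimately have "c \<in> H \<theta>"
      using models model_subset by blast
    then show ?thesis using c by blast
  qed (use ex in blast)
  then have ex_c: "\<exists>c\<in>H \<theta>. coloring_code c \<and> (\<forall>M\<in>?N. c \<in> elts (f M))"
    using f by simp
  have "dfn T (\<lambda>s. coloring_code (s 0) \<and> (\<forall>M\<in>?N. s 0 \<in> elts (f M)))"
    using models T(1) Suc.prems(1) f model_nonempty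
    by (intro dfn_conj dfn_coloring_code dfn_finite_ball dfn_mem dtm_var dtm_const) auto
  from elementary_ex[OF model_elementary this ex_c]
  obtain c where c: "c \<in> T" "coloring_code c" "\<forall>M\<in>?N. c \<in> elts (f M)"
    using models T(1) by blast
  then have "c \<in> \<Inter>\<M>"
    using f by auto
  then show ?case using c(2) by blast
qed simp

lemma coloring_imp_twisted:
  assumes n: "n \<ge> 2" and \<chi>: "acceptable_coloring n A E \<chi>"
  shows "twisted \<theta> n A E"
  unfolding twisted_def
proof (intro allI impI)
  fix \<M> k
  assume "test_set \<theta> n A E \<M> \<and> k < n"
  then have ts: "test_set \<theta> n A E \<M>" and k: "k < n" by auto
  have models: "\<forall>M\<in>\<M>. model M"
    using ts unfolding test_set_def model_def by blast
  \<comment> \<open>A test set has \<open>n - 1\<close> models, at least one because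
    \<open>n\<close> is at least 2.\<close>
  have "\<M> \<noteq> {}"
    using ts n unfolding test_set_def by auto
  then obtain c where c: "\<And>M. M \<in> \<M> \<Longrightarrow> c \<in> M" "coloring_code c"
    using coloring_code_in_all_models[OF coloring_code_exists[OF \<chi>], of \<M>] ts models
    unfolding test_set_def by blast
  let ?X = "{x \<in> elts A - \<Union>\<M>. \<forall>i\<in>{..<n} - {k}. set_of (E i `` {x}) \<in> \<Union>\<M>}"
  have col_k: "pair x (num k) \<in> elts c" if x: "x \<in> ?X" for x
  proof -
    obtain i where i: "i < n" "pair x (num i) \<in> elts c"
      using c(2) x unfolding coloring_code_def by blast
    have "i = k"
    proof (rule ccontr)
      assume "i \<noteq> k"
      then obtain M where "M \<in> \<M>" "cls i x \<in> M"
        using x i(1) unfolding cls_def by blast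
      then have "x \<in> M"
        using coloring_code_in_model[OF _ c(2) _ _ i] c(1) models x by blast
      then show False using x \<open>M \<in> \<M>\<close> by blast
    qed
    then show ?thesis using i by simp
  qed
  show "small (elts A) (E k) ?X"
    unfolding small_def
  proof (intro conjI ballI)
    fix C
    assume "C \<in> elts A // E k"
    then obtain a where a: "a \<in> elts A" "C = E k `` {a}"
      by (rule quotientE)
    obtain X where X: "internally_finite X" "elts X \<subseteq> elts A"
      "\<And>x. x \<in> elts A \<Longrightarrow> (a, x) \<in> E k \<Longrightarrow> pair x (num k) \<in> elts c \<Longrightarrow> x \<in> elts X"
      using c(2) a(1) k unfolding coloring_code_def by blast
    have "C \<inter> ?X \<subseteq> elts X"
      using X(3) col_k a(2) by auto
    then show "finite (C \<inter> ?X)"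
      using X internally_finite_iff finite_subset by blast
  qed blast
qed

end

theorem theorem2p7:
  fixes n :: nat and \<theta> :: "'k rel" and A :: "'k hs" and E :: "nat \<Rightarrow> 'k hs rel"
  assumes "n \<ge> 2"
    and "grid n A E"
    and "large_regular \<theta> A"
  shows "twisted \<theta> n A E \<longleftrightarrow> (\<exists>\<chi>. acceptable_coloring n A E \<chi>)"
proof -
  have \<theta>: "Card_order \<theta>" "regularCard \<theta>" "natLeq <o \<theta>" "|Pow (trcl A)| <o \<theta>"
    using assms(3) by (auto simp: large_regular_def)
  \<comment> \<open>This puts \<open>A\<close> into \<open>H \<theta>\<close>; the power set bound
    below lets \<open>H \<theta>\<close> recognize finiteness of subsets of
    \<open>A\<close>.\<close>
  have "|trcl A| <o \<theta>"
    using card_of_Pow \<theta>(4) by (rule ordLess_transitive)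
  moreover have "|Pow (elts A)| <o \<theta>"
    using elts_subset_trcl \<theta>(4) by (metis Pow_mono card_of_mono1 ordLeq_ordLess_trans)
  ultimately interpret large_grid_universe \<theta> n A E
    using \<theta> assms(2) by unfold_locales (auto simp: H_def)
  show ?thesis
    using twisted_imp_coloring coloring_imp_twisted assms(1) by auto
qed

end
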